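(* Suppose that the assumptions (T1), (T2) and (C1) listed in the context hold. Then under the alternative hypothesis $H_{A,\Delta}$ of at least one relevant change point, that is, $|\Delta\mu_h|>\Delta_h$ for some $h\in\{1,\dots,d\}$, we have $$\mathcal T_{d,n}\longrightarrow\infty\quad\text{in probability as }d,n\to\infty,$$ which in particular gives $\lim_{d,n\to\infty}\mathbb P(\mathcal T_{d,n}>g_{1-\alpha})=1$.
   Context: Model. $\{\varepsilon_j\}_{j\in\mathbb Z}$ is a sequence of i.i.d. random variables with values in some measure space $\mathbb S$; for each $h\in\mathbb N$, $g_h:\mathbb S^{\mathbb N}\to\mathbb R$ is measurable and $X_{j,h}=g_h(\varepsilon_j,\varepsilon_{j-1},\dots)$ is centered and real valued. For each component $h$ there are means $\mu_h^{(1)},\mu_h^{(2)}\in\mathbb R$ and an unknown constant $t_h\in(0,1)$; $\Delta\mu_h=\mu_h^{(1)}-\mu_h^{(2)}$; one sets $t_h=1/2$ whenever $\Delta\mu_h=0$. Observations: $Z_{j,h}=\mu_{j,h}+X_{j,h}$, $1\le j\le n$, $1\le h\le d$, with $\mu_{j,h}=\mu_h^{(1)}$ for $j\le\lfloor nt_h\rfloor$ and $\mu_{j,h}=\mu_h^{(2)}$ for $j>\lfloor nt_h\rfloor$. The dimension $d$ converges to infinity with $n\to\infty$. $\Delta_h>0$ are given thresholds. Dependence quantities. $\varepsilon_0'$ is an independent copy of $\varepsilon_0$, $X_{j,h}'=g_h(\varepsilon_j,\dots,\varepsilon_1,\varepsilon_0',\varepsilon_{-1},\dots)$, $\vartheta_{j,h,p}=\|X_{j,h}-X_{j,h}'\|_p$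 with $\|Y\|_p=(\mathbb E|Y|^p)^{1/p}$. $\phi_h(j)=\mathrm{Cov}(X_{0,h},X_{j,h})$, $\sigma_h^2=\sum_{j\in\mathbb Z}\phi_h(j)$ ($\sigma_h\ge0$). Assumptions ($\lesssim$ means up to a constant independent of $n,d,j$). There are $p>4$ and constants $\delta\in(0,1)$, $\sigma_+,\sigma_->0$, $\mathbf t\in(0,1/2)$ such that: (T1) $\sup_{h\in\mathbb N}\vartheta_{j,h,p}\lesssim\delta^j$. (T2) $\sigma_-\le\inf_{h\in\mathbb N}\sigma_h\le\sup_{h\in\mathbb N}\sigma_h\le\sigma_+$. (C1) $\mathbf t\le t_h\le1-\mathbf t$ for all $h\in\mathbb N$. Estimators. $\mathbb U_{n,h}(s)=\frac1n\sum_{j=1}^{\lfloor ns\rfloor}Z_{j,h}-\frac{\lfloor ns\rfloor}{n^2}\sum_{j=1}^nZ_{j,h}$; $\hat t_h=\arg\max_{s\in(\mathbf t,1-\mathbf t)}|\mathbb U_{n,h}(s)|$. With a user-specified constant $S\in(0,1)$ put $\hat I_{h,1}=\{j:1\le j\le n\max\{S\hat t_h,\mathbf t\}\}$, $\hat I_{h,2}=\{j:n-n\max\{S(1-\hat t_h),\mathbf t\}<j\le n\}$; for $q=1,2$ let $\bar Z_h^{(q)}$ be the mean of $Z_{j,h}$ over $j\in\hat I_{h,q}$, $\hat\phi_h^{(q)}(i)=\frac{1}{|\hat I_{h,q}|-|i|}\sum_{j:\,j,j+i\in\hat I_{h,q}}(Z_{j,h}-\bar Z_h^{(q)})(Z_{j+i,h}-\bar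 Z_h^{(q)})$, $\hat\sigma_{h,q}^2=\sum_{|i|\le\beta_n}\hat\phi_h^{(q)}(i)$ with bandwidth $\beta_n\sim n^B$, $B\in(0,1/2)$, and $\hat\sigma_h^2=\min\{s_+^2,\max\{s_-^2,\frac12(\hat\sigma_{h,1}^2+\hat\sigma_{h,2}^2)\}\}$, where $0<s_-$ and $s_+$ are a sufficiently small and a sufficiently large constant, respectively. Test statistic. $\tau(t)=\frac{2\sqrt{1+2t(1-t)}}{\sqrt5\,t(1-t)}$; $\hat{\mathbb M}_{n,h}^2=\frac{3}{(\hat t_h(1-\hat t_h))^2}\int_0^1\mathbb U_{n,h}^2(s)\,ds$; $\hat T_{n,h}^{(\Delta)}=\frac{\sqrt n}{\tau(\hat t_h)\hat\sigma_h\Delta_h}(\hat{\mathbb M}_{n,h}^2-\Delta_h^2)$; $\mathcal T_{d,n}=a_d\big(\max_{h=1}^d\hat T_{n,h}^{(\Delta)}-b_d\big)$, where $a_d=\sqrt{2\log d}$, $b_d=a_d-\frac{\log(4\pi\log d)}{2a_d}$. $g_{1-\alpha}$ is the $(1-\alpha)$-quantile of the Gumbel distribution with distribution function $x\mapsto e^{-e^{-x}}$.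
   Formalization: The growth condition log d = o(n) is added; with no rate the claim fails, e.g. for d = exp(n^2), bounded i.i.d. noise and one fixed jump, where the statistic tends to minus infinity. *)

theory Defs
  imports "HOL-Probability.Probability" "HOL-Library.Landau_Symbols"
begin

text \<open>
  Time is indexed by \<^typ>\<open>int\<close>, so that the innovations form a two-sided sequence and the
  observations are the values at \<open>1, \<dots>, n\<close>.  Components are indexed by \<open>h = 1, 2, \<dots>\<close> of type
  \<^typ>\<open>nat\<close>; the index \<open>0\<close> is never used.
\<close>


section \<open>The model\<close>

definition noise ::
  "(nat \<Rightarrow> (nat \<Rightarrow> 's) \<Rightarrow> real) \<Rightarrow> (int \<Rightarrow> 'a \<Rightarrow> 's) \<Rightarrow> int \<Rightarrow> nat \<Rightarrow> 'a \<Rightarrow> real" where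
  "noise g \<epsilon> j h \<omega> = g h (\<lambda>k. \<epsilon> (j - int k) \<omega>)"

text \<open>The noise with the innovation at time \<open>0\<close> replaced by \<open>\<epsilon>'\<close>.\<close>

definition coupled_noise ::
  "(nat \<Rightarrow> (nat \<Rightarrow> 's) \<Rightarrow> real) \<Rightarrow> (int \<Rightarrow> 'a \<Rightarrow> 's) \<Rightarrow> ('a \<Rightarrow> 's) \<Rightarrow> int \<Rightarrow> nat \<Rightarrow> 'a \<Rightarrow> real" where
  "coupled_noise g \<epsilon> \<epsilon>' = noise g (\<epsilon>(0 := \<epsilon>'))"

definition mean_function ::
  "(nat \<Rightarrow> real) \<Rightarrow> (nat \<Rightarrow> real) \<Rightarrow> (nat \<Rightarrow> real) \<Rightarrow> nat \<Rightarrow> int \<Rightarrow> nat \<Rightarrow> real" where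
  "mean_function \<mu>1 \<mu>2 t n j h = (if j \<le> \<lfloor>real n * t h\<rfloor> then \<mu>1 h else \<mu>2 h)"

definition observation ::
  "(nat \<Rightarrow> (nat \<Rightarrow> 's) \<Rightarrow> real) \<Rightarrow> (int \<Rightarrow> 'a \<Rightarrow> 's) \<Rightarrow> (nat \<Rightarrow> real) \<Rightarrow> (nat \<Rightarrow> real) \<Rightarrow> (nat \<Rightarrow> real)
    \<Rightarrow> nat \<Rightarrow> 'a \<Rightarrow> nat \<Rightarrow> int \<Rightarrow> real" where
  "observation g \<epsilon> \<mu>1 \<mu>2 t n \<omega> h j = mean_function \<mu>1 \<mu>2 t n j h + noise g \<epsilon> j h \<omega>"


section \<open>Dependence quantities\<close>

text \<open>
  The Bochner integral of a non-integrable function is \<open>0\<close>; finiteness of the norm therefore has to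
  be stated separately (see \<open>geometric_dependence\<close>).
\<close>

definition Lp_norm :: "'a measure \<Rightarrow> real \<Rightarrow> ('a \<Rightarrow> real) \<Rightarrow> real" where
  "Lp_norm M p Y = (\<integral>\<omega>. \<bar>Y \<omega>\<bar> powr p \<partial>M) powr (1 / p)"

definition dependence_coeff ::
  "'a measure \<Rightarrow> (nat \<Rightarrow> (nat \<Rightarrow> 's) \<Rightarrow> real) \<Rightarrow> (int \<Rightarrow> 'a \<Rightarrow> 's) \<Rightarrow> ('a \<Rightarrow> 's)
    \<Rightarrow> nat \<Rightarrow> nat \<Rightarrow> real \<Rightarrow> real" where
  "dependence_coeff M g \<epsilon> \<epsilon>' j h p =
     Lp_norm M p (\<lambda>\<omega>. noise g \<epsilon> (int j) h \<omega> - coupled_noise g \<epsilon> \<epsilon>' (int j) h \<omega>)"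

definition geometric_dependence ::
  "'a measure \<Rightarrow> (nat \<Rightarrow> (nat \<Rightarrow> 's) \<Rightarrow> real) \<Rightarrow> (int \<Rightarrow> 'a \<Rightarrow> 's) \<Rightarrow> ('a \<Rightarrow> 's)
    \<Rightarrow> real \<Rightarrow> real \<Rightarrow> bool" where
  "geometric_dependence M g \<epsilon> \<epsilon>' p \<delta> \<longleftrightarrow>
     (\<exists>C. \<forall>j. \<forall>h\<ge>1.
        integrable M (\<lambda>\<omega>. \<bar>noise g \<epsilon> (int j) h \<omega> - coupled_noise g \<epsilon> \<epsilon>' (int j) h \<omega>\<bar> powr p) \<and>
        dependence_coeff M g \<epsilon> \<epsilon>' j h p \<le> C * \<delta> ^ j)"

definition covariance :: "'a measure \<Rightarrow> ('a \<Rightarrow> real) \<Rightarrow> ('a \<Rightarrow> real) \<Rightarrow> real" where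
  "covariance M X Y =
     (\<integral>\<omega>. (X \<omega> - (\<integral>\<omega>'. X \<omega>' \<partial>M)) * (Y \<omega> - (\<integral>\<omega>'. Y \<omega>' \<partial>M)) \<partial>M)"

definition autocov ::
  "'a measure \<Rightarrow> (nat \<Rightarrow> (nat \<Rightarrow> 's) \<Rightarrow> real) \<Rightarrow> (int \<Rightarrow> 'a \<Rightarrow> 's) \<Rightarrow> nat \<Rightarrow> int \<Rightarrow> real" where
  "autocov M g \<epsilon> h j = covariance M (noise g \<epsilon> 0 h) (noise g \<epsilon> j h)"

definition long_run_sd ::
  "'a measure \<Rightarrow> (nat \<Rightarrow> (nat \<Rightarrow> 's) \<Rightarrow> real) \<Rightarrow> (int \<Rightarrow> 'a \<Rightarrow> 's) \<Rightarrow> nat \<Rightarrow> real" where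
  "long_run_sd M g \<epsilon> h = sqrt (\<Sum>\<^sub>\<infinity>j\<in>UNIV. autocov M g \<epsilon> h j)"


section \<open>Estimators\<close>

text \<open>
  In this section \<open>z j\<close> is the observation of a single component at time \<open>j\<close>, \<open>th\<close> is the estimated
  change point and \<open>tb\<close> is the trimming constant that bounds the change points away from \<open>0\<close> and \<open>1\<close>.
\<close>

definition cusum :: "nat \<Rightarrow> (int \<Rightarrow> real) \<Rightarrow> real \<Rightarrow> real" where
  "cusum n z s =
     1 / real n * (\<Sum>j=1..\<lfloor>real n * s\<rfloor>. z j)
     - of_int \<lfloor>real n * s\<rfloor> / (real n)\<^sup>2 * (\<Sum>j=1..int n. z j)"

text \<open>
  The CUSUM process is a step function, so its maximiser exists but is never unique; hence a
  predicate rather than a function.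
\<close>

definition is_change_point_estimate :: "real \<Rightarrow> nat \<Rightarrow> (int \<Rightarrow> real) \<Rightarrow> real \<Rightarrow> bool" where
  "is_change_point_estimate tb n z th \<longleftrightarrow>
     is_arg_max (\<lambda>s. \<bar>cusum n z s\<bar>) (\<lambda>s. s \<in> {tb<..<1 - tb}) th"

definition first_block :: "real \<Rightarrow> real \<Rightarrow> nat \<Rightarrow> real \<Rightarrow> int set" where
  "first_block tb S n th = {j. 1 \<le> j \<and> of_int j \<le> real n * max (S * th) tb}"

definition second_block :: "real \<Rightarrow> real \<Rightarrow> nat \<Rightarrow> real \<Rightarrow> int set" where
  "second_block tb S n th =
     {j. real n - real n * max (S * (1 - th)) tb < of_int j \<and> j \<le> int n}"

definition block_mean :: "int set \<Rightarrow> (int \<Rightarrow> real) \<Rightarrow> real" where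
  "block_mean I z = (\<Sum>j\<in>I. z j) / real (card I)"

definition block_autocov :: "int set \<Rightarrow> (int \<Rightarrow> real) \<Rightarrow> int \<Rightarrow> real" where
  "block_autocov I z i =
     1 / (real (card I) - \<bar>of_int i\<bar>) *
     (\<Sum>j | j \<in> I \<and> j + i \<in> I. (z j - block_mean I z) * (z (j + i) - block_mean I z))"

definition block_lrv :: "real \<Rightarrow> int set \<Rightarrow> (int \<Rightarrow> real) \<Rightarrow> real" where
  "block_lrv b I z = (\<Sum>i | \<bar>of_int i\<bar> \<le> b. block_autocov I z i)"

definition lrv_estimate ::
  "real \<Rightarrow> real \<Rightarrow> real \<Rightarrow> real \<Rightarrow> real \<Rightarrow> nat \<Rightarrow> (int \<Rightarrow> real) \<Rightarrow> real \<Rightarrow> real" where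
  "lrv_estimate tb S b s_min s_max n z th =
     min (s_max\<^sup>2) (max (s_min\<^sup>2)
       (1 / 2 * (block_lrv b (first_block tb S n th) z + block_lrv b (second_block tb S n th) z)))"

definition tau :: "real \<Rightarrow> real" where
  "tau t = 2 * sqrt (1 + 2 * t * (1 - t)) / (sqrt 5 * t * (1 - t))"

definition M_hat_sq :: "nat \<Rightarrow> (int \<Rightarrow> real) \<Rightarrow> real \<Rightarrow> real" where
  "M_hat_sq n z th = 3 / (th * (1 - th))\<^sup>2 * integral {0..1} (\<lambda>s. (cusum n z s)\<^sup>2)"

definition T_hat ::
  "real \<Rightarrow> real \<Rightarrow> real \<Rightarrow> real \<Rightarrow> real \<Rightarrow> real \<Rightarrow> nat \<Rightarrow> (int \<Rightarrow> real) \<Rightarrow> real \<Rightarrow> real" where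
  "T_hat tb S b s_min s_max \<Delta> n z th =
     sqrt (real n) / (tau th * sqrt (lrv_estimate tb S b s_min s_max n z th) * \<Delta>)
       * (M_hat_sq n z th - \<Delta>\<^sup>2)"


section \<open>The test\<close>

definition gumbel_scale :: "nat \<Rightarrow> real" where
  "gumbel_scale d = sqrt (2 * ln (real d))"

definition gumbel_centre :: "nat \<Rightarrow> real" where
  "gumbel_centre d = gumbel_scale d - ln (4 * pi * ln (real d)) / (2 * gumbel_scale d)"

text \<open>Here \<open>z h j\<close> is the observation of component \<open>h\<close> at time \<open>j\<close>, and \<open>th h\<close> its change point estimate.\<close>

definition max_statistic ::
  "real \<Rightarrow> real \<Rightarrow> real \<Rightarrow> real \<Rightarrow> real \<Rightarrow> (nat \<Rightarrow> real) \<Rightarrow> nat \<Rightarrow> nat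
    \<Rightarrow> (nat \<Rightarrow> int \<Rightarrow> real) \<Rightarrow> (nat \<Rightarrow> real) \<Rightarrow> real" where
  "max_statistic tb S b s_min s_max \<Delta> d n z th =
     gumbel_scale d *
       ((MAX h\<in>{1..d}. T_hat tb S b s_min s_max (\<Delta> h) n (z h) (th h)) - gumbel_centre d)"

definition gumbel_cdf :: "real \<Rightarrow> real" where
  "gumbel_cdf x = exp (- exp (- x))"

definition gumbel_quantile :: "real \<Rightarrow> real" where
  "gumbel_quantile q = Inf {x. q \<le> gumbel_cdf x}"

definition tends_to_infinity_in_prob :: "'a measure \<Rightarrow> (nat \<Rightarrow> 'a \<Rightarrow> real) \<Rightarrow> bool" where
  "tends_to_infinity_in_prob M Y \<longleftrightarrow>
     (\<forall>K. (\<lambda>n. measure M {\<omega> \<in> space M. Y n \<omega> > K}) \<longlonglongrightarrow> 1)"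

end

theory Submission
  imports Defs
begin

text \<open>
  The means and the thresholds do not depend on \<open>n\<close>, so the alternative fixes a component \<open>h\<close> with
  \<open>D\<^sup>2 > \<Delta>\<^sup>2\<close>, \<open>D\<close> being its jump, and \<open>h \<le> d\<close> for large \<open>n\<close>.  If all partial sums of its noise are
  at most \<open>\<eta> n\<close> in absolute value, its CUSUM process is uniformly close to \<open>D\<close> times the tent function
  \<open>min s t - s t\<close>.  The tent has a sharp peak at \<open>t\<close>, hence the estimated change point is close to \<open>t\<close>,
  and its square integrates to \<open>(t (1 - t))\<^sup>2 / 3\<close>, hence the estimated squared jump is close to \<open>D\<^sup>2\<close>.
  The studentised statistic of this component is then of order \<open>sqrt n\<close>, which dominates the
  centring of order \<open>sqrt (ln d)\<close>.

  The partial sums are uniformly \<open>o(n)\<close> in probability by density in \<open>L\<^sup>1\<close>: the functions of the innovations that satisfy such a law form a closed subspace,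
  which contains the indicators of cylinder sets, as these give finite-range dependent sequences.
\<close>


section \<open>Uniform laws of large numbers\<close>

text \<open>The integrable majorant \<open>W\<close> stands for the maximal absolute partial sum, whose expectation is to
  be \<open>o(n)\<close>.\<close>

definition uniform_lln :: "'a measure \<Rightarrow> (int \<Rightarrow> 'a \<Rightarrow> real) \<Rightarrow> bool" where
  "uniform_lln M Y \<longleftrightarrow>
     (\<forall>e>0. \<forall>\<^sub>F n in sequentially. \<exists>W. integrable M W \<and>
        (\<forall>\<omega>\<in>space M. \<forall>l\<le>int n. \<bar>\<Sum>j=1..l. Y j \<omega>\<bar> \<le> W \<omega>) \<and> (\<integral>\<omega>. W \<omega> \<partial>M) \<le> e * real n)"

lemma uniform_lln_zero: "uniform_lln M (\<lambda>_ _. 0)"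
  unfolding uniform_lln_def by (auto intro!: exI[of _ "\<lambda>_. 0"] always_eventually)

lemma uniform_lln_cong:
  assumes "uniform_lln M Y" and "\<And>j \<omega>. \<omega> \<in> space M \<Longrightarrow> Y' j \<omega> = Y j \<omega>"
  shows "uniform_lln M Y'"
  using assms by (simp add: uniform_lln_def)

lemma uniform_lln_add:
  assumes "uniform_lln M Y" and "uniform_lln M Y'"
  shows "uniform_lln M (\<lambda>j \<omega>. Y j \<omega> + Y' j \<omega>)"
  unfolding uniform_lln_def
proof (intro allI impI)
  fix e :: real assume "e > 0"
  then have "e / 2 > 0" by simp
  from assms[unfolded uniform_lln_def, rule_format, OF this]
  show "\<forall>\<^sub>F n in sequentially. \<exists>W. integrable M W \<and>
      (\<forall>\<omega>\<in>space M. \<forall>l\<le>int n. \<bar>\<Sum>j=1..l. Y j \<omega> + Y' j \<omega>\<bar> \<le> W \<omega>) \<and> (\<integral>\<omega>. W \<omega> \<partial>M) \<le> e * real n"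
  proof eventually_elim
    case (elim n)
    from elim(1) obtain W where W: "integrable M W"
      and le: "\<forall>\<omega>\<in>space M. \<forall>l\<le>int n. \<bar>\<Sum>j=1..l. Y j \<omega>\<bar> \<le> W \<omega>"
      and int: "(\<integral>\<omega>. W \<omega> \<partial>M) \<le> e / 2 * real n"
      by blast
    from elim(2) obtain W' where W': "integrable M W'"
      and le': "\<forall>\<omega>\<in>space M. \<forall>l\<le>int n. \<bar>\<Sum>j=1..l. Y' j \<omega>\<bar> \<le> W' \<omega>"
      and int': "(\<integral>\<omega>. W' \<omega> \<partial>M) \<le> e / 2 * real n"
      by blast
    show ?case
    proof (intro exI conjI ballI allI impI)
      show "integrable M (\<lambda>\<omega>. W \<omega> + W' \<omega>)" using W W' by simp
      show "(\<integral>\<omega>. W \<omega> + W' \<omega> \<partial>M) \<le> e * real n" using W W' int int' by simp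
      fix \<omega> l assume "\<omega> \<in> space M" "l \<le> int n"
      then have "\<bar>\<Sum>j=1..l. Y j \<omega>\<bar> \<le> W \<omega>" "\<bar>\<Sum>j=1..l. Y' j \<omega>\<bar> \<le> W' \<omega>"
        using le le' by auto
      then show "\<bar>\<Sum>j=1..l. Y j \<omega> + Y' j \<omega>\<bar> \<le> W \<omega> + W' \<omega>"
        by (simp add: sum.distrib)
    qed
  qed
qed

lemma uniform_lln_scale:
  assumes "uniform_lln M Y"
  shows "uniform_lln M (\<lambda>j \<omega>. c * Y j \<omega>)"
  unfolding uniform_lln_def
proof (intro allI impI)
  fix e :: real assume e: "e > 0"
  \<comment> \<open>The denominator is |c| + 1 so that c = 0 is covered too.\<close>
  then have "e / (\<bar>c\<bar> + 1) > 0" by simp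
  from assms[unfolded uniform_lln_def, rule_format, OF this]
  show "\<forall>\<^sub>F n in sequentially. \<exists>W. integrable M W \<and>
      (\<forall>\<omega>\<in>space M. \<forall>l\<le>int n. \<bar>\<Sum>j=1..l. c * Y j \<omega>\<bar> \<le> W \<omega>) \<and> (\<integral>\<omega>. W \<omega> \<partial>M) \<le> e * real n"
  proof eventually_elim
    case (elim n)
    then obtain W where W: "integrable M W"
      and le: "\<And>\<omega> l. \<omega> \<in> space M \<Longrightarrow> l \<le> int n \<Longrightarrow> \<bar>\<Sum>j=1..l. Y j \<omega>\<bar> \<le> W \<omega>"
      and int: "(\<integral>\<omega>. W \<omega> \<partial>M) \<le> e / (\<bar>c\<bar> + 1) * real n"
      by blast
    show ?case
    proof (intro exI conjI ballI allI impI)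
      show "integrable M (\<lambda>\<omega>. \<bar>c\<bar> * W \<omega>)" using W by simp
      have "(\<integral>\<omega>. \<bar>c\<bar> * W \<omega> \<partial>M) \<le> \<bar>c\<bar> * (e / (\<bar>c\<bar> + 1) * real n)"
        using W mult_left_mono[OF int, of "\<bar>c\<bar>"] by simp
      also have "\<dots> = \<bar>c\<bar> / (\<bar>c\<bar> + 1) * (e * real n)" by simp
      also have "\<dots> \<le> 1 * (e * real n)"
        using e by (intro mult_right_mono) auto
      finally show "(\<integral>\<omega>. \<bar>c\<bar> * W \<omega> \<partial>M) \<le> e * real n" by simp
      fix \<omega> l assume "\<omega> \<in> space M" "l \<le> int n"
      then show "\<bar>\<Sum>j=1..l. c * Y j \<omega>\<bar> \<le> \<bar>c\<bar> * W \<omega>"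
        using le[of \<omega> l] by (simp flip: sum_distrib_left add: abs_mult mult_left_mono)
    qed
  qed
qed

text \<open>Replacing Y by Y' moves every partial sum up to n by at most the sum of |Y j - Y' j|
  over 1..n, whose expectation is at most e n. Hence the triangle inequality alone gives closedness
  under approximation in L^1 that is uniform in j.\<close>

lemma uniform_lln_approx:
  assumes approx: "\<And>e. e > 0 \<Longrightarrow> \<exists>Y'. uniform_lln M Y' \<and>
      (\<forall>j. integrable M (\<lambda>\<omega>. Y j \<omega> - Y' j \<omega>)) \<and> (\<forall>j. (\<integral>\<omega>. \<bar>Y j \<omega> - Y' j \<omega>\<bar> \<partial>M) \<le> e)"
  shows "uniform_lln M Y"
  unfolding uniform_lln_def
proof (intro allI impI)
  fix e :: real assume "e > 0"
  then have e: "e / 2 > 0" by simp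
  from approx[OF e] obtain Y' where Y': "uniform_lln M Y'"
      "\<And>j. integrable M (\<lambda>\<omega>. Y j \<omega> - Y' j \<omega>)" "\<And>j. (\<integral>\<omega>. \<bar>Y j \<omega> - Y' j \<omega>\<bar> \<partial>M) \<le> e / 2"
    by blast
  from Y'(1)[unfolded uniform_lln_def, rule_format, OF e]
  show "\<forall>\<^sub>F n in sequentially. \<exists>W. integrable M W \<and>
      (\<forall>\<omega>\<in>space M. \<forall>l\<le>int n. \<bar>\<Sum>j=1..l. Y j \<omega>\<bar> \<le> W \<omega>) \<and> (\<integral>\<omega>. W \<omega> \<partial>M) \<le> e * real n"
  proof eventually_elim
    case (elim n)
    then obtain W where W: "integrable M W"
      and le: "\<And>\<omega> l. \<omega> \<in> space M \<Longrightarrow> l \<le> int n \<Longrightarrow> \<bar>\<Sum>j=1..l. Y' j \<omega>\<bar> \<le> W \<omega>"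
      and int: "(\<integral>\<omega>. W \<omega> \<partial>M) \<le> e / 2 * real n"
      by blast
    let ?R = "\<lambda>\<omega>. \<Sum>j=1..int n. \<bar>Y j \<omega> - Y' j \<omega>\<bar>"
    show ?case
    proof (intro exI conjI ballI allI impI)
      show "integrable M (\<lambda>\<omega>. W \<omega> + ?R \<omega>)" using W Y'(2) by auto
      have "(\<integral>\<omega>. ?R \<omega> \<partial>M) = (\<Sum>j=1..int n. \<integral>\<omega>. \<bar>Y j \<omega> - Y' j \<omega>\<bar> \<partial>M)"
        using Y'(2) by (intro Bochner_Integration.integral_sum) auto
      also have "\<dots> \<le> (\<Sum>j=1..int n. e / 2)" by (intro sum_mono Y'(3))
      finally have "(\<integral>\<omega>. ?R \<omega> \<partial>M) \<le> e / 2 * real n" by (simp add: mult.commute)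
      then show "(\<integral>\<omega>. W \<omega> + ?R \<omega> \<partial>M) \<le> e * real n"
        using W int Y'(2) by (subst Bochner_Integration.integral_add) auto
      fix \<omega> l assume \<omega>: "\<omega> \<in> space M" and l: "l \<le> int n"
      have "\<bar>\<Sum>j=1..l. Y j \<omega>\<bar> = \<bar>(\<Sum>j=1..l. Y' j \<omega>) + (\<Sum>j=1..l. Y j \<omega> - Y' j \<omega>)\<bar>"
        by (simp flip: sum.distrib)
      also have "\<dots> \<le> \<bar>\<Sum>j=1..l. Y' j \<omega>\<bar> + (\<Sum>j=1..l. \<bar>Y j \<omega> - Y' j \<omega>\<bar>)"
        by (intro order_trans[OF abs_triangle_ineq] add_left_mono sum_abs)
      also have "\<dots> \<le> W \<omega> + ?R \<omega>"
        using l by (intro add_mono le[OF \<omega> l] sum_mono2) auto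
      finally show "\<bar>\<Sum>j=1..l. Y j \<omega>\<bar> \<le> W \<omega> + ?R \<omega>" .
    qed
  qed
qed

section \<open>Bounded sequences with correlations of finite range\<close>

context prob_space
begin

text \<open>In the expanded square each index meets at most 2k + 1 indices within distance k, and
  boundedness makes each of these terms at most 1; so the growth in l is linear.\<close>

lemma second_moment_finite_range:
  fixes Y :: "int \<Rightarrow> 'a \<Rightarrow> real"
  assumes [measurable]: "\<And>j. Y j \<in> borel_measurable M"
    and bound: "\<And>j \<omega>. \<omega> \<in> space M \<Longrightarrow> \<bar>Y j \<omega>\<bar> \<le> 1"
    and uncorr: "\<And>i j. \<bar>i - j\<bar> > k \<Longrightarrow> expectation (\<lambda>\<omega>. Y i \<omega> * Y j \<omega>) = 0"
  shows "integrable M (\<lambda>\<omega>. (\<Sum>j=1..l. Y j \<omega>)\<^sup>2)"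
    and "expectation (\<lambda>\<omega>. (\<Sum>j=1..l. Y j \<omega>)\<^sup>2) \<le> real (nat l) * real (nat (2 * k + 1))"
proof -
  have b: "\<bar>Y i \<omega> * Y j \<omega>\<bar> \<le> 1" if "\<omega> \<in> space M" for i j \<omega>
    using bound[OF that, of i] bound[OF that, of j] by (simp add: abs_mult mult_le_one)
  have int: "integrable M (\<lambda>\<omega>. Y i \<omega> * Y j \<omega>)" for i j
    by (rule integrable_const_bound[of _ 1]) (use b in auto)
  have sq: "(\<Sum>j=1..l. Y j \<omega>)\<^sup>2 = (\<Sum>i=1..l. \<Sum>j=1..l. Y i \<omega> * Y j \<omega>)" for \<omega>
    by (simp add: power2_eq_square sum_product)
  show "integrable M (\<lambda>\<omega>. (\<Sum>j=1..l. Y j \<omega>)\<^sup>2)"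
    unfolding sq using int by auto
  have le1: "expectation (\<lambda>\<omega>. Y i \<omega> * Y j \<omega>) \<le> (if j \<in> {i-k..i+k} then 1 else 0)" for i j
  proof (cases "\<bar>i - j\<bar> > k")
    case True
    then show ?thesis using uncorr[OF True] by auto
  next
    case False
    moreover have "expectation (\<lambda>\<omega>. Y i \<omega> * Y j \<omega>) \<le> expectation (\<lambda>\<omega>. 1)"
      using b[of _ i j] int[of i j] by (intro integral_mono) (auto simp: abs_le_iff)
    ultimately show ?thesis by (auto simp: prob_space)
  qed
  have "expectation (\<lambda>\<omega>. (\<Sum>j=1..l. Y j \<omega>)\<^sup>2) = (\<Sum>i=1..l. \<Sum>j=1..l. expectation (\<lambda>\<omega>. Y i \<omega> * Y j \<omega>))"
    unfolding sq using int by simp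
  also have "\<dots> \<le> (\<Sum>i=1..l. \<Sum>j=1..l. if j \<in> {i-k..i+k} then 1 else 0)"
    by (intro sum_mono le1)
  also have "\<dots> \<le> (\<Sum>i=1..l. real (nat (2 * k + 1)))"
  proof (intro sum_mono)
    fix i
    have "(\<Sum>j=1..l. if j \<in> {i-k..i+k} then 1 else 0) = real (card ({1..l} \<inter> {i-k..i+k}))"
      by (subst sum.inter_restrict[symmetric]) auto
    also have "\<dots> \<le> real (card {i-k..i+k})" by (intro of_nat_mono card_mono) auto
    also have "card {i-k..i+k} = nat (2 * k + 1)" by simp
    finally show "(\<Sum>j=1..l. if j \<in> {i-k..i+k} then 1 else 0) \<le> real (nat (2 * k + 1))" .
  qed
  also have "\<dots> = real (nat l) * real (nat (2 * k + 1))" by simp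
  finally show "expectation (\<lambda>\<omega>. (\<Sum>j=1..l. Y j \<omega>)\<^sup>2) \<le> real (nat l) * real (nat (2 * k + 1))" .
qed

text \<open>Chebyshev's inequality on a grid of mesh \<open>e n\<close>, whose number of points does not depend on
  \<open>n\<close>; boundedness controls the partial sums between two grid points.\<close>

lemma uniform_lln_finite_range:
  fixes Y :: "int \<Rightarrow> 'a \<Rightarrow> real"
  assumes meas: "\<And>j. Y j \<in> borel_measurable M"
    and bound: "\<And>j \<omega>. \<omega> \<in> space M \<Longrightarrow> \<bar>Y j \<omega>\<bar> \<le> 1"
    and uncorr: "\<And>i j. \<bar>i - j\<bar> > k \<Longrightarrow> expectation (\<lambda>\<omega>. Y i \<omega> * Y j \<omega>) = 0"
  shows "uniform_lln M Y"
  unfolding uniform_lln_def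
proof (intro allI impI)
  fix e0 :: real assume e0: "e0 > 0"
  \<comment> \<open>A quarter, because the majorant below has expectation at most 4 e n: two parts
    for \<open>L\<close>, one for the constant e n, one for the squares.\<close>
  define e where "e = e0 / 4"
  have e: "e > 0" using e0 by (simp add: e_def)
  \<comment> \<open>This many steps of length at least e n reach n.\<close>
  define m where "m = \<lceil>1 / e\<rceil>"
  have m: "1 / e \<le> m" "m \<ge> 1" using e by (auto simp: m_def)
  define C where "C = real (nat (2 * k + 1))"
  \<comment> \<open>The first bound makes rounding e n up cost at most a factor 2; by the second,
    the m + 1 grid terms, each at most 2 m C in expectation, add up to at most e n.\<close>
  have "\<forall>\<^sub>F n::nat in sequentially. real n \<ge> 1 / e \<and> real n \<ge> (m + 1) * (2 * m * C) / e"
    by (intro eventually_conj filterlim_at_top[THEN iffD1, rule_format] filterlim_real_sequentially)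
  then show "\<forall>\<^sub>F n in sequentially. \<exists>W. integrable M W \<and>
      (\<forall>\<omega>\<in>space M. \<forall>l\<le>int n. \<bar>\<Sum>j=1..l. Y j \<omega>\<bar> \<le> W \<omega>) \<and> (\<integral>\<omega>. W \<omega> \<partial>M) \<le> e0 * real n"
  proof eventually_elim
    case (elim n)
    define L where "L = \<lceil>e * n\<rceil>"
    have en: "e * n \<ge> 1" using elim e by (simp add: field_simps)
    have L: "L \<ge> 1" "e * n \<le> L" "L \<le> e * n + 1" using en unfolding L_def by linarith+
    define S where "S = (\<lambda>l \<omega>. \<Sum>j=1..l. Y j \<omega>)"
    \<comment> \<open>From |S| \<le> S^2 / (e n) + e n, a grid value is bounded through its square,
      and the sum over the grid dominates whichever square occurs; \<open>L\<close> pays for the way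
      from the grid point below l to l.\<close>
    define W where "W = (\<lambda>\<omega>. L + e * n + (\<Sum>i=0..m. (S (L * i) \<omega>)\<^sup>2 / (e * n)))"
    have intS: "integrable M (\<lambda>\<omega>. (S l \<omega>)\<^sup>2)" for l
      unfolding S_def by (rule second_moment_finite_range[OF meas bound uncorr])
    have expS: "expectation (\<lambda>\<omega>. (S l \<omega>)\<^sup>2) \<le> real (nat l) * C" for l
      unfolding S_def C_def by (rule second_moment_finite_range[OF meas bound uncorr])
    show ?case
    proof (intro exI conjI ballI allI impI)
      show "integrable M W" unfolding W_def using intS by (intro Bochner_Integration.integrable_add) auto
      have "expectation W = L + e * n + (\<Sum>i=0..m. expectation (\<lambda>\<omega>. (S (L * i) \<omega>)\<^sup>2) / (e * n))"
        unfolding W_def using intS by (simp add: prob_space)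
      also have "\<dots> \<le> (e * n + e * n) + e * n + (\<Sum>i=0..m. (2 * m * C))"
      proof (intro add_mono sum_mono)
        fix i assume i: "i \<in> {0..m}"
        have "real (nat (L * i)) = real_of_int L * i" using i L by simp
        also have "\<dots> \<le> (2 * (e * n)) * m" using i L en by (intro mult_mono) auto
        finally have "real (nat (L * i)) * C \<le> (2 * (e * n)) * m * C" unfolding C_def by (intro mult_right_mono) auto
        then have "expectation (\<lambda>\<omega>. (S (L * i) \<omega>)\<^sup>2) \<le> (2 * (e * n)) * m * C"
          using expS[of "L * i"] by linarith
        then show "expectation (\<lambda>\<omega>. (S (L * i) \<omega>)\<^sup>2) / (e * n) \<le> 2 * m * C"
          using en by (subst pos_divide_le_eq) (auto simp: algebra_simps)
      qed (use L en in auto)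
      also have "(\<Sum>i=0..m. (2 * m * C)) = (m + 1) * (2 * m * C)" using m by simp
      also have "\<dots> \<le> e * n" using elim e by (simp add: field_simps)
      finally show "expectation W \<le> e0 * n" by (simp add: e_def)
      fix \<omega> l assume \<omega>: "\<omega> \<in> space M" and l: "l \<le> int n"
      have pos: "(S (L * i) \<omega>)\<^sup>2 / (e * n) \<ge> 0" for i using e by simp
      show "\<bar>\<Sum>j=1..l. Y j \<omega>\<bar> \<le> W \<omega>"
      proof (cases "l < 0")
        case True
        then show ?thesis unfolding W_def using L e pos by (auto intro!: add_nonneg_nonneg sum_nonneg)
      next
        case False
        define i where "i = l div L"
        have split: "l = L * i + l mod L" and r: "0 \<le> l mod L" "l mod L < L"
          using L by (simp_all add: i_def)
        have Li: "L * i \<le> l" using split r by linarith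
        have i: "0 \<le> i" using False L by (simp add: i_def pos_imp_zdiv_nonneg_iff)
        have "i \<le> m"
        proof -
          have "real_of_int L * i \<le> l" using Li by (simp flip: of_int_mult)
          also have "\<dots> \<le> n" using l by linarith
          also have "\<dots> \<le> e * n * m" using m e mult_left_mono[of "1/e" m "e * n"] by simp
          also have "\<dots> \<le> real_of_int L * m" using L m by (intro mult_right_mono) auto
          finally have "real_of_int L * i \<le> real_of_int L * m" .
          then show ?thesis using L by simp
        qed
        have "\<bar>S (L * i) \<omega>\<bar> * (2 * (e * n)) \<le> (S (L * i) \<omega>)\<^sup>2 + (e * n)\<^sup>2"
          using sum_squares_bound[of "\<bar>S (L * i) \<omega>\<bar>" "e * n"] by (simp add: algebra_simps)
        moreover have "0 \<le> \<bar>S (L * i) \<omega>\<bar> * (e * n)" using en by simp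
        ultimately have "\<bar>S (L * i) \<omega>\<bar> * (e * n) \<le> (S (L * i) \<omega>)\<^sup>2 + (e * n)\<^sup>2" by linarith
        also have "\<dots> = ((S (L * i) \<omega>)\<^sup>2 / (e * n) + e * n) * (e * n)"
          using en by (auto simp: distrib_right power2_eq_square[of "e * n"])
        finally have "\<bar>S (L * i) \<omega>\<bar> * (e * n) \<le> ((S (L * i) \<omega>)\<^sup>2 / (e * n) + e * n) * (e * n)" .
        then have 1: "\<bar>S (L * i) \<omega>\<bar> \<le> (S (L * i) \<omega>)\<^sup>2 / (e * n) + e * n"
          using en by (subst (asm) mult_le_cancel_right) auto
        have 2: "(S (L * i) \<omega>)\<^sup>2 / (e * n) \<le> (\<Sum>i=0..m. (S (L * i) \<omega>)\<^sup>2 / (e * n))"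
          using pos i \<open>i \<le> m\<close> by (intro member_le_sum) auto
        have "{1..l} = {1..L * i} \<union> {L * i + 1..l}" 
        proof -
          have "0 \<le> L * i" using i L by simp
          then show ?thesis using Li by (intro set_eqI) (simp only: Un_iff atLeastAtMost_iff, linarith)
        qed
        then have "S l \<omega> = S (L * i) \<omega> + (\<Sum>j=L * i + 1..l. Y j \<omega>)"
          unfolding S_def by (simp only:) (rule sum.union_disjoint, auto)
        moreover have "\<bar>\<Sum>j=L * i + 1..l. Y j \<omega>\<bar> \<le> (\<Sum>j=L * i + 1..l. 1)"
          using bound[OF \<omega>] by (intro order_trans[OF sum_abs] sum_mono) auto
        moreover have "(\<Sum>j=L * i + 1..l. 1::real) \<le> L"
        proof -
          have "real_of_int (l - L * i) \<le> L" using split r by (subst of_int_le_iff) linarith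
          then show ?thesis using Li by simp
        qed
        ultimately have "\<bar>S l \<omega>\<bar> \<le> \<bar>S (L * i) \<omega>\<bar> + L" by linarith
        then show ?thesis using 1 2 by (simp add: W_def S_def)
      qed
    qed
  qed
qed

end


section \<open>Functions of independent identically distributed innovations\<close>

text \<open>Events indexed by a finite J are moved to the image of J by the inverse of f, where the
  product formula is available. This serves both to reverse time and to drop the independent
  copy.\<close>

lemma (in prob_space) indep_vars_reindex:
  assumes X: "indep_vars (\<lambda>_. N) X I" and f: "inj_on f K" "f ` K \<subseteq> I"
  shows "indep_vars (\<lambda>_. N) (\<lambda>k. X (f k)) K"
  unfolding indep_vars_def2
proof
  let ?F = "\<lambda>i. {X i -` A \<inter> space M |A. A \<in> sets N}"
  have X': "\<forall>i\<in>I. random_variable N (X i)" "indep_sets ?F I"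
    using X by (auto simp: indep_vars_def2)
  show rv: "\<forall>k\<in>K. random_variable N (X (f k))" using X' f by auto
  show "indep_sets (\<lambda>k. ?F (f k)) K"
  proof (rule indep_setsI)
    show "?F (f k) \<subseteq> events" if "k \<in> K" for k
      using that rv by (auto intro: measurable_sets)
    fix A J assume J: "J \<noteq> {}" "J \<subseteq> K" "finite J" and A: "\<forall>j\<in>J. A j \<in> ?F (f j)"
    let ?B = "\<lambda>i. A (the_inv_into J f i)"
    have inj: "inj_on f J" using f J by (blast intro: inj_on_subset)
    have B: "?B (f j) = A j" if "j \<in> J" for j
      using that by (simp add: the_inv_into_f_f[OF inj])
    have "prob (\<Inter>i\<in>f ` J. ?B i) = (\<Prod>i\<in>f ` J. prob (?B i))"
      by (rule indep_setsD[OF X'(2)]) (use J f A B in auto)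
    then show "prob (\<Inter>j\<in>J. A j) = (\<Prod>j\<in>J. prob (A j))"
      by (simp add: prod.reindex[OF inj] B)
  qed
qed

section \<open>Pasts of an i.i.d. sequence and their common law\<close>

locale iid_innovations = prob_space M for M :: "'a measure" +
  fixes N :: "'s measure" and \<epsilon> :: "int \<Rightarrow> 'a \<Rightarrow> 's"
  assumes indep: "indep_vars (\<lambda>_. N) \<epsilon> UNIV"
    and ident: "distr M N (\<epsilon> j) = distr M N (\<epsilon> 0)"
begin

definition past :: "int \<Rightarrow> 'a \<Rightarrow> nat \<Rightarrow> 's" where
  "past j \<omega> = (\<lambda>k. \<epsilon> (j - int k) \<omega>)"

text \<open>The common law of all \<open>past j\<close>, by \<open>distr_past\<close>: stationarity
  turns statements about every time j into statements about this one measure.\<close>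

definition past_law :: "(nat \<Rightarrow> 's) measure" where
  "past_law = (\<Pi>\<^sub>M k\<in>UNIV. distr M N (\<epsilon> 0))"

text \<open>The centring is linear on integrable functions and annihilates constants, so the law can
  be extended from sets to functions.\<close>

definition centred :: "((nat \<Rightarrow> 's) \<Rightarrow> real) \<Rightarrow> int \<Rightarrow> 'a \<Rightarrow> real" where
  "centred f j \<omega> = f (past j \<omega>) - (\<integral>x. f x \<partial>past_law)"

lemma innovation_measurable [measurable]: "\<epsilon> j \<in> measurable M N"
  using indep by (simp add: indep_vars_def)

lemma sets_past_law [measurable_cong]: "sets past_law = sets (\<Pi>\<^sub>M k\<in>UNIV. N)"
  unfolding past_law_def by (intro sets_PiM_cong) auto

lemma past_measurable_PiM: "past j \<in> measurable M (\<Pi>\<^sub>M k\<in>UNIV. N)"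
proof -
  have "(\<lambda>\<omega>. \<lambda>k\<in>UNIV. \<epsilon> (j - int k) \<omega>) \<in> measurable M (\<Pi>\<^sub>M k\<in>UNIV. N)"
    by (rule measurable_restrict) simp
  then show ?thesis unfolding past_def[abs_def] restrict_UNIV .
qed

lemma past_measurable [measurable]: "past j \<in> measurable M past_law"
  using past_measurable_PiM by (simp add: measurable_cong_sets[OF refl sets_past_law])

lemma prob_innovation: "A \<in> sets N \<Longrightarrow> prob (\<epsilon> j -` A \<inter> space M) = measure (distr M N (\<epsilon> 0)) A"
  by (simp add: measure_distr flip: ident[of j])

text \<open>The innovations in reversed time are independent, so their joint law is a product, and
  identical marginals remove the dependence on j.\<close>

lemma distr_past: "distr M past_law (past j) = past_law"
proof -
  have "indep_vars (\<lambda>k::nat. N) (\<lambda>k. \<epsilon> (j - int k)) UNIV"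
    by (rule indep_vars_reindex[OF indep]) (auto simp: inj_on_def)
  then have "distr M (\<Pi>\<^sub>M k\<in>UNIV. N) (\<lambda>\<omega>. \<lambda>k\<in>UNIV. \<epsilon> (j - int k) \<omega>)
      = (\<Pi>\<^sub>M k\<in>UNIV. distr M N (\<epsilon> (j - int k)))"
    by (subst (asm) indep_vars_iff_distr_eq_PiM) auto
  also have "\<dots> = past_law"
    unfolding past_law_def by (intro PiM_cong refl ident)
  finally show ?thesis
    unfolding past_def[abs_def] restrict_UNIV by (simp cong: distr_cong[OF refl sets_past_law])
qed

lemma
  fixes f :: "(nat \<Rightarrow> 's) \<Rightarrow> real"
  assumes "integrable past_law f"
  shows integrable_past: "integrable M (\<lambda>\<omega>. f (past j \<omega>))"
    and expectation_past: "expectation (\<lambda>\<omega>. f (past j \<omega>)) = (\<integral>x. f x \<partial>past_law)"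
proof -
  have [measurable]: "f \<in> borel_measurable past_law" using assms by auto
  show "integrable M (\<lambda>\<omega>. f (past j \<omega>))"
    using assms integrable_distr[of "past j" M past_law f] by (simp add: distr_past)
  show "expectation (\<lambda>\<omega>. f (past j \<omega>)) = (\<integral>x. f x \<partial>past_law)"
    using integral_distr[of "past j" M past_law f] by (simp add: distr_past)
qed

lemma prob_space_past_law: "prob_space past_law"
  using prob_space_distr[of "past 0" past_law] by (simp add: distr_past)

lemma integrable_indicator_past_law [simp]:
  "A \<in> sets past_law \<Longrightarrow> integrable past_law (indicator A :: (nat \<Rightarrow> 's) \<Rightarrow> real)"
  using prob_space.emeasure_le_1[OF prob_space_past_law, of A]
  by (intro integrable_real_indicator) (auto intro: le_less_trans)

text \<open>Dominated convergence gives convergence in L^1 of \<open>past_law\<close>; by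
  stationarity the same bound holds at all times j, as \<open>uniform_lln_approx\<close>
  demands.\<close>

lemma uniform_lln_limit:
  fixes f :: "(nat \<Rightarrow> 's) \<Rightarrow> real"
  assumes f: "integrable past_law f"
    and s: "\<And>i. integrable past_law (s i)" "\<And>i. uniform_lln M (centred (s i))"
    and lim: "\<And>x. x \<in> space past_law \<Longrightarrow> (\<lambda>i::nat. s i x) \<longlonglongrightarrow> f x"
    and w: "integrable past_law w" "\<And>i x. x \<in> space past_law \<Longrightarrow> \<bar>s i x\<bar> \<le> w x"
  shows "uniform_lln M (centred f)"
proof (rule uniform_lln_approx)
  fix e :: real assume e: "e > 0"
  interpret Q: prob_space past_law by (rule prob_space_past_law)
  have [measurable]: "f \<in> borel_measurable past_law" "\<And>i. s i \<in> borel_measurable past_law"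
    using f s by auto
  have "(\<lambda>i. \<integral>x. \<bar>f x - s i x\<bar> \<partial>past_law) \<longlonglongrightarrow> (\<integral>x. 0 \<partial>past_law)"
  proof (rule integral_dominated_convergence[where w = "\<lambda>x. \<bar>f x\<bar> + w x"])
    show "AE x in past_law. (\<lambda>i. \<bar>f x - s i x\<bar>) \<longlonglongrightarrow> 0"
      using lim by (intro AE_I2 tendsto_rabs_zero) (auto intro!: tendsto_eq_intros)
    show "AE x in past_law. norm \<bar>f x - s i x\<bar> \<le> \<bar>f x\<bar> + w x" for i
      using w(2)[of _ i] by (intro AE_I2) (auto intro: order_trans[OF abs_triangle_ineq4])
  qed (use f w in auto)
  \<comment> \<open>Half of e for the function and half for its centring constant, which moves by no
    more than the L^1 distance.\<close>
  then have "\<forall>\<^sub>F i in sequentially. (\<integral>x. \<bar>f x - s i x\<bar> \<partial>past_law) < e / 2"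
    using e by (intro order_tendstoD(2)) auto
  then obtain i where i: "(\<integral>x. \<bar>f x - s i x\<bar> \<partial>past_law) < e / 2"
    by (auto dest: eventually_happens)
  have [simp]: "integrable past_law (\<lambda>x. f x - s i x)" using f s by auto
  have *: "centred f j \<omega> - centred (s i) j \<omega>
      = (\<lambda>x. f x - s i x) (past j \<omega>) - (\<integral>x. f x - s i x \<partial>past_law)" for j \<omega>
    using f s by (simp add: centred_def)
  have "\<bar>\<integral>x. f x - s i x \<partial>past_law\<bar> \<le> e / 2"
    using i integral_abs_bound[of past_law "\<lambda>x. f x - s i x"] by linarith
  have "expectation (\<lambda>\<omega>. \<bar>centred f j \<omega> - centred (s i) j \<omega>\<bar>) \<le> e" for j
  proof -
    have "expectation (\<lambda>\<omega>. \<bar>centred f j \<omega> - centred (s i) j \<omega>\<bar>)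
        \<le> expectation (\<lambda>\<omega>. \<bar>f (past j \<omega>) - s i (past j \<omega>)\<bar> + e / 2)"
      unfolding * using integrable_past[of "\<lambda>x. f x - s i x" j] \<open>_ \<le> e / 2\<close>
      by (intro integral_mono) auto
    also have "\<dots> = (\<integral>x. \<bar>f x - s i x\<bar> \<partial>past_law) + e / 2"
      using integrable_past[of "\<lambda>x. \<bar>f x - s i x\<bar>" j] expectation_past[of "\<lambda>x. \<bar>f x - s i x\<bar>" j]
      by (simp add: prob_space)
    finally show ?thesis using i by linarith
  qed
  moreover have "integrable M (\<lambda>\<omega>. centred f j \<omega> - centred (s i) j \<omega>)" for j
    unfolding * using integrable_past[of "\<lambda>x. f x - s i x" j] by auto
  ultimately show "\<exists>Y'. uniform_lln M Y' \<and> (\<forall>j. integrable M (\<lambda>\<omega>. centred f j \<omega> - Y' j \<omega>)) \<and>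
      (\<forall>j. expectation (\<lambda>\<omega>. \<bar>centred f j \<omega> - Y' j \<omega>\<bar>) \<le> e)"
    using s(2) by blast
qed

section \<open>From cylinder sets to integrable functions\<close>

lemma prob_cylinder:
  assumes "finite J" "J \<noteq> {}" and "\<And>i. i \<in> J \<Longrightarrow> E i \<in> sets N"
  shows "prob {\<omega>\<in>space M. \<forall>i\<in>J. \<epsilon> i \<omega> \<in> E i} = (\<Prod>i\<in>J. measure (distr M N (\<epsilon> 0)) (E i))"
proof -
  have "{\<omega>\<in>space M. \<forall>i\<in>J. \<epsilon> i \<omega> \<in> E i} = (\<Inter>i\<in>J. \<epsilon> i -` E i \<inter> space M)"
    using assms(2) by auto
  also have "prob \<dots> = (\<Prod>i\<in>J. prob (\<epsilon> i -` E i \<inter> space M))"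
    by (rule indep_varsD[OF indep]) (use assms in auto)
  also have "\<dots> = (\<Prod>i\<in>J. measure (distr M N (\<epsilon> 0)) (E i))"
    using assms by (intro prod.cong prob_innovation) auto
  finally show ?thesis .
qed

text \<open>Membership of the past in a cylinder set depends on finitely many innovations only, so
  shifts by more than the largest coordinate are uncorrelated.\<close>

lemma uniform_lln_cylinder:
  assumes J: "finite J" "J \<noteq> {}" and E: "\<And>k. k \<in> J \<Longrightarrow> E k \<in> sets N"
  defines "A \<equiv> prod_emb UNIV (\<lambda>_. N) J (\<Pi>\<^sub>E k\<in>J. E k)"
  shows "uniform_lln M (centred (indicator A))"
proof (rule uniform_lln_finite_range[where k = "int (Max J)"])
  interpret Q: prob_space past_law by (rule prob_space_past_law)
  have A: "A \<in> sets past_law"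
    unfolding A_def sets_past_law using J E by (intro sets_PiM_I) auto
  have A_iff: "past j \<omega> \<in> A \<longleftrightarrow> (\<forall>k\<in>J. \<epsilon> (j - int k) \<omega> \<in> E k)" if "\<omega> \<in> space M" for j \<omega>
    using measurable_space[OF innovation_measurable that]
    by (auto simp: A_def prod_emb_def past_def PiE_iff extensional_def)
  show "centred (indicator A) j \<in> borel_measurable M" for j
    unfolding centred_def[abs_def] using A by measurable
  define q where "q = (\<Prod>k\<in>J. measure (distr M N (\<epsilon> 0)) (E k))"
  have one: "prob {\<omega>\<in>space M. past j \<omega> \<in> A} = q" for j
  proof -
    have inj: "inj_on (\<lambda>k. j - int k) J" by (auto simp: inj_on_def)
    have "{\<omega>\<in>space M. past j \<omega> \<in> A} =
        {\<omega>\<in>space M. \<forall>i\<in>(\<lambda>k. j - int k) ` J. \<epsilon> i \<omega> \<in> E (nat (j - i))}"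
      by (auto simp: A_iff)
    also have "prob \<dots> = q"
      using J E by (subst prob_cylinder) (auto simp: q_def prod.reindex[OF inj])
    finally show ?thesis .
  qed
  have int1: "(\<integral>\<omega>. indicator A (past j \<omega>) \<partial>M) = q" for j
  proof -
    have "(\<integral>\<omega>. indicator A (past j \<omega>) \<partial>M) = (\<integral>\<omega>. indicator {\<omega>\<in>space M. past j \<omega> \<in> A} \<omega> \<partial>M)"
      by (intro Bochner_Integration.integral_cong) (auto simp: indicator_def)
    also have "\<dots> = q" using A one[of j] by simp
    finally show ?thesis .
  qed
  have "integrable past_law (indicator A :: _ \<Rightarrow> real)" using A by simp
  then have q: "(\<integral>x. indicator A x \<partial>past_law) = q"
    using expectation_past[of "indicator A" 0] int1[of 0] by metis
  have c: "centred (indicator A) j \<omega> = indicator A (past j \<omega>) - q" for j \<omega>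
    unfolding centred_def q ..
  have "0 \<le> q" "q \<le> 1" using one[of 0, symmetric] by auto
  then show "\<bar>centred (indicator A) j \<omega>\<bar> \<le> 1" for j \<omega>
    by (auto simp: c indicator_def)
  show "expectation (\<lambda>\<omega>. centred (indicator A) a \<omega> * centred (indicator A) b \<omega>) = 0"
    if "int (Max J) < \<bar>a - b\<bar>" for a b
  proof -
    let ?Ja = "(\<lambda>k. a - int k) ` J" and ?Jb = "(\<lambda>k. b - int k) ` J"
    have le: "int k \<le> int (Max J)" if "k \<in> J" for k using J that by simp
    \<comment> \<open>A common index would give |a - b| = |k - l| \<le> Max J for some k, l in
      J.\<close>
    have disj: "?Ja \<inter> ?Jb = {}"
    proof (rule ccontr)
      assume "?Ja \<inter> ?Jb \<noteq> {}"
      then obtain k l where "k \<in> J" "l \<in> J" "a - int k = b - int l" by auto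
      then show False using le[of k] le[of l] that by linarith
    qed
    have inj: "inj_on (\<lambda>k. a - int k) J" "inj_on (\<lambda>k. b - int k) J" by (auto simp: inj_on_def)
    \<comment> \<open>Glues the two conditions into a single cylinder; disjointness makes the choice
      consistent.\<close>
    define F where "F = (\<lambda>i. if i \<in> ?Ja then E (nat (a - i)) else E (nat (b - i)))"
    have Fa: "F (a - int k) = E k" if "k \<in> J" for k using that by (simp add: F_def)
    have Fb: "F (b - int k) = E k" if "k \<in> J" for k
      using that disj by (auto simp: F_def)
    have F: "F i \<in> sets N" if "i \<in> ?Ja \<union> ?Jb" for i
      using that E Fa Fb by auto
    have "{\<omega>\<in>space M. past a \<omega> \<in> A \<and> past b \<omega> \<in> A} =
        {\<omega>\<in>space M. \<forall>i\<in>?Ja \<union> ?Jb. \<epsilon> i \<omega> \<in> F i}"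
      by (simp add: A_iff ball_Un Fa Fb cong: conj_cong)
    also have "prob \<dots> = (\<Prod>i\<in>?Ja \<union> ?Jb. measure (distr M N (\<epsilon> 0)) (F i))"
      using J F by (intro prob_cylinder) auto
    also have "\<dots> = (\<Prod>i\<in>?Ja. measure (distr M N (\<epsilon> 0)) (F i)) * (\<Prod>i\<in>?Jb. measure (distr M N (\<epsilon> 0)) (F i))"
      using J disj by (intro prod.union_disjoint) auto
    also have "\<dots> = q * q"
      using Fa Fb by (simp add: prod.reindex[OF inj(1)] prod.reindex[OF inj(2)] q_def)
    finally have both: "prob {\<omega>\<in>space M. past a \<omega> \<in> A \<and> past b \<omega> \<in> A} = q * q" .
    have "(\<integral>\<omega>. indicator A (past a \<omega>) * indicator A (past b \<omega>) \<partial>M)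
        = (\<integral>\<omega>. indicator {\<omega>\<in>space M. past a \<omega> \<in> A \<and> past b \<omega> \<in> A} \<omega> \<partial>M :: real)"
      by (intro Bochner_Integration.integral_cong) (auto simp: indicator_def)
    also have "\<dots> = q * q" using A both by simp
    finally have int2: "(\<integral>\<omega>. indicator A (past a \<omega>) * indicator A (past b \<omega>) \<partial>M) = q * q" .
    have [simp]: "integrable M (\<lambda>\<omega>. indicator A (past j \<omega>) :: real)" for j
      using A by (intro integrable_past) auto
    have [simp]: "integrable M (\<lambda>\<omega>. indicator A (past a \<omega>) * indicator A (past b \<omega>) :: real)"
      using A by (intro integrable_const_bound[of _ 1]) (auto simp: indicator_def)
    have "expectation (\<lambda>\<omega>. centred (indicator A) a \<omega> * centred (indicator A) b \<omega>)
      = expectation (\<lambda>\<omega>. indicator A (past a \<omega>) * indicator A (past b \<omega>)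
          - q * indicator A (past a \<omega>) - q * indicator A (past b \<omega>) + q * q)"
      by (simp add: c algebra_simps)
    also have "\<dots> = q * q - q * q - q * q + q * q"
      using int1 int2 by (simp add: prob_space)
    finally show ?thesis by simp
  qed
qed

text \<open>Dynkin's argument: the cylinder sets are a generator stable under intersection, and the
  sets satisfying the law are closed under complements and countable disjoint unions.\<close>

lemma uniform_lln_indicator:
  assumes "A \<in> sets past_law"
  shows "uniform_lln M (centred (indicator A))"
proof -
  interpret Q: prob_space past_law by (rule prob_space_past_law)
  let ?\<Omega> = "\<Pi>\<^sub>E k\<in>(UNIV::nat set). space N"
  have sp: "?\<Omega> = space past_law"
    using sets_eq_imp_space_eq[OF sets_past_law] by (simp add: space_PiM)
  have ss: "sigma_sets ?\<Omega> (prod_algebra UNIV (\<lambda>_. N)) = sets past_law"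
    by (simp add: sets_past_law sets_PiM)
  from assms have "A \<in> sigma_sets ?\<Omega> (prod_algebra UNIV (\<lambda>_. N))"
    by (simp add: ss)
  with Int_stable_prod_algebra prod_algebra_sets_into_space show ?thesis
  proof (induction rule: sigma_sets_induct_disjoint)
    case (basic A)
    then obtain J E where "A = prod_emb UNIV (\<lambda>_. N) J (\<Pi>\<^sub>E k\<in>J. E k)" "finite J" "J \<noteq> {}"
        "\<And>k. k \<in> J \<Longrightarrow> E k \<in> sets N"
      by (rule prod_algebraE) auto
    then show ?case using uniform_lln_cylinder by auto
  next
    case empty
    from uniform_lln_zero show ?case by (rule uniform_lln_cong) (simp add: centred_def)
  next
    case (compl A)
    then have A: "A \<in> sets past_law" by (simp add: ss)
    \<comment> \<open>Passing to the complement replaces the indicator and its mean by 1 minus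
      themselves, so the centred indicator only changes sign.\<close>
    from uniform_lln_scale[OF compl.IH, of "-1"] show ?case
    proof (rule uniform_lln_cong)
      fix j \<omega> assume "\<omega> \<in> space M"
      then have "past j \<omega> \<in> space past_law" by (rule measurable_space[OF past_measurable])
      then show "centred (indicator (?\<Omega> - A)) j \<omega> = - 1 * centred (indicator A) j \<omega>"
        using A Q.prob_compl[OF A] unfolding centred_def sp
        by (simp add: sets.compl_sets) (simp add: indicator_def)
    qed
  next
    case (union A)
    then have A: "A i \<in> sets past_law" for i using ss by auto
    have disj: "disjoint_family A" by fact
    have eq: "indicator (\<Union>i<m. A i) x = (\<Sum>i<m. indicator (A i) x :: real)" for m x
      using disj by (intro indicator_UN_disjoint) (auto simp: disjoint_family_on_def)
    \<comment> \<open>Finite disjoint unions follow by additivity; the countable union is then a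
      pointwise limit dominated by 1.\<close>
    have fin: "uniform_lln M (centred (indicator (\<Union>i<m. A i)))" for m
    proof (induction m)
      case 0
      from uniform_lln_zero show ?case by (rule uniform_lln_cong) (simp add: centred_def)
    next
      case (Suc m)
      from uniform_lln_add[OF Suc union.IH[of m]] show ?case
      proof (rule uniform_lln_cong)
        fix j \<omega>
        have ind: "(indicator (\<Union>i<Suc m. A i) :: _ \<Rightarrow> real)
            = (\<lambda>x. indicator (\<Union>i<m. A i) x + indicator (A m) x)"
          by (simp add: eq fun_eq_iff)
        have "(\<Union>i<m. A i) \<in> sets past_law" using A by blast
        then have "(\<integral>x. indicator (\<Union>i<Suc m. A i) x \<partial>past_law)
            = (\<integral>x. indicator (\<Union>i<m. A i) x \<partial>past_law) + (\<integral>x. indicator (A m) x \<partial>past_law :: real)"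
          unfolding ind using A by (intro Bochner_Integration.integral_add integrable_indicator_past_law)
        then show "centred (indicator (\<Union>i<Suc m. A i)) j \<omega>
            = centred (indicator (\<Union>i<m. A i)) j \<omega> + centred (indicator (A m)) j \<omega>"
          unfolding centred_def ind by simp
      qed
    qed
    show ?case
    proof (rule uniform_lln_limit[where s = "\<lambda>m. indicator (\<Union>i<m. A i)" and w = "\<lambda>_. 1"])
      show "(\<lambda>m. indicator (\<Union>i<m. A i) x :: real) \<longlonglongrightarrow> indicator (\<Union>i. A i) x" for x
        by (rule LIMSEQ_indicator_UN)
      have "(\<Union>i. A i) \<in> sets past_law" "(\<Union>i<m. A i) \<in> sets past_law" for m using A by blast+
      then show "integrable past_law (indicator (\<Union>i. A i) :: _ \<Rightarrow> real)"
          "integrable past_law (indicator (\<Union>i<m. A i) :: _ \<Rightarrow> real)" for m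
        by (intro integrable_indicator_past_law; blast)+
    qed (use fin in \<open>auto simp: indicator_def\<close>)
  qed
qed

text \<open>Integrable functions arise from multiples of indicators by sums and by pointwise limits
  dominated by 2 |f|; the law survives each of these.\<close>

theorem uniform_lln_integrable:
  fixes f :: "(nat \<Rightarrow> 's) \<Rightarrow> real"
  assumes "integrable past_law f"
  shows "uniform_lln M (centred f)"
  using assms
proof (induction rule: integrable_induct)
  case (base A c)
  from uniform_lln_scale[OF uniform_lln_indicator[OF base(1)], of c] show ?case
    by (rule uniform_lln_cong) (use base in \<open>simp add: centred_def algebra_simps\<close>)
next
  case (add f g)
  from uniform_lln_add[OF add.IH] show ?case
    by (rule uniform_lln_cong) (use add in \<open>simp add: centred_def\<close>)
next
  case (lim f s)
  show ?case
    by (rule uniform_lln_limit[of f s "\<lambda>x. 2 * \<bar>f x\<bar>"]) (use lim in auto)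
qed

end


section \<open>Measurability of the test statistic\<close>

lemma cusum_eq_floor:
  "cusum n z s = (\<lambda>k. 1 / real n * (\<Sum>j=1..k. z j) - of_int k / (real n)\<^sup>2 * (\<Sum>j=1..int n. z j)) \<lfloor>real n * s\<rfloor>"
  by (simp add: cusum_def)

text \<open>Joint measurability in sample point and time makes the time integral of the squared
  process a random variable. Time enters only through the integer
  \<open>\<lfloor>real n * s\<rfloor>\<close>, so countably many measurable pieces are put
  together.\<close>

lemma cusum_measurable_pair:
  assumes [measurable]: "\<And>j. (\<lambda>\<omega>. z \<omega> j) \<in> borel_measurable M"
  shows "(\<lambda>x. cusum n (z (fst x)) (snd x)) \<in> borel_measurable (M \<Otimes>\<^sub>M borel)"
  unfolding cusum_eq_floor
  by (rule measurable_compose_countable[where f = "\<lambda>k x. (\<lambda>k. 1 / real n * (\<Sum>j=1..k. z (fst x) j)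
        - of_int k / (real n)\<^sup>2 * (\<Sum>j=1..int n. z (fst x) j)) k" and g = "\<lambda>x. \<lfloor>real n * snd x\<rfloor>"])
    measurable

lemma cusum_measurable [measurable]: "cusum n z \<in> borel_measurable borel"
  unfolding cusum_def[abs_def]
  by (rule measurable_compose_countable[where f = "\<lambda>k x. 1 / real n * (\<Sum>j=1..k. z j)
        - of_int k / (real n)\<^sup>2 * (\<Sum>j=1..int n. z j)" and g = "\<lambda>x. \<lfloor>real n * x\<rfloor>"])
    measurable

text \<open>On [0, 1] the process takes at most n + 1 values, and the sum of their squares is a
  bound.\<close>

lemma set_integrable_cusum_sq: "set_integrable lborel {0..1} (\<lambda>s. (cusum n z s)\<^sup>2)"
proof -
  define F where "F = (\<lambda>k. 1 / real n * (\<Sum>j=1..k. z j) - of_int k / (real n)\<^sup>2 * (\<Sum>j=1..int n. z j))"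
  have bound: "(cusum n z s)\<^sup>2 \<le> (\<Sum>k=0..int n. (F k)\<^sup>2)" if "s \<in> {0..1}" for s
  proof -
    have "real n * s \<le> real n" using that mult_left_le[of s "real n"] by simp
    then have "\<lfloor>real n * s\<rfloor> \<le> int n" by linarith
    moreover have "0 \<le> \<lfloor>real n * s\<rfloor>" using that by simp
    ultimately have "(F \<lfloor>real n * s\<rfloor>)\<^sup>2 \<le> (\<Sum>k=0..int n. (F k)\<^sup>2)"
      by (intro member_le_sum) auto
    then show ?thesis by (simp add: cusum_def F_def)
  qed
  show ?thesis
    unfolding set_integrable_def
    by (rule integrableI_bounded_set[where A = "{0..1}" and B = "\<Sum>k=0..int n. (F k)\<^sup>2"])
      (use bound in \<open>auto simp: indicator_def\<close>)
qed

lemma integrable_on_cusum_sq: "(\<lambda>s. (cusum n z s)\<^sup>2) integrable_on {0..1}"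
  by (rule set_borel_integral_eq_integral(1)[OF set_integrable_cusum_sq])

lemma M_hat_sq_measurable:
  assumes [measurable]: "\<And>j. (\<lambda>\<omega>. z \<omega> j) \<in> borel_measurable M" "th \<in> borel_measurable M"
  shows "(\<lambda>\<omega>. M_hat_sq n (z \<omega>) (th \<omega>)) \<in> borel_measurable M"
proof -
  have [measurable]: "(\<lambda>x. cusum n (z (fst x)) (snd x)) \<in> borel_measurable (M \<Otimes>\<^sub>M lborel)"
    using cusum_measurable_pair[of z M n] by simp
  have "(\<lambda>\<omega>. LINT s|lborel. indicator {0..1} s *\<^sub>R (cusum n (z \<omega>) s)\<^sup>2) \<in> borel_measurable M"
    by (intro lborel.borel_measurable_lebesgue_integral) (simp add: split_beta)
  \<comment> \<open>The statistic is defined by the gauge integral, the measurability of parameter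
    integrals is that of the Lebesgue integral; the two agree here.\<close>
  also have "(\<lambda>\<omega>. LINT s|lborel. indicator {0..1} s *\<^sub>R (cusum n (z \<omega>) s)\<^sup>2)
      = (\<lambda>\<omega>. integral {0..1} (\<lambda>s. (cusum n (z \<omega>) s)\<^sup>2))"
    using set_borel_integral_eq_integral(2)[OF set_integrable_cusum_sq]
    by (simp add: set_lebesgue_integral_def)
  finally show ?thesis unfolding M_hat_sq_def[abs_def] by measurable
qed

text \<open>As integer intervals, the blocks depend on the estimate only through one integer, so the
  variance estimate is a countable composition of measurable functions.\<close>

lemma first_block_eq: "first_block tb S n th = {1..\<lfloor>real n * max (S * th) tb\<rfloor>}"
  by (auto simp: first_block_def le_floor_iff)

lemma second_block_eq: "second_block tb S n th = {\<lfloor>real n - real n * max (S * (1 - th)) tb\<rfloor> + 1..int n}"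
  by (auto simp: second_block_def add1_zle_eq floor_less_iff)

lemma block_lrv_measurable:
  assumes [measurable]: "\<And>j. (\<lambda>\<omega>. z \<omega> j) \<in> borel_measurable M"
  shows "(\<lambda>\<omega>. block_lrv b I (z \<omega>)) \<in> borel_measurable M"
  unfolding block_lrv_def block_autocov_def block_mean_def by measurable

lemma T_hat_measurable:
  assumes [measurable]: "\<And>j. (\<lambda>\<omega>. z \<omega> j) \<in> borel_measurable M" "th \<in> borel_measurable M"
  shows "(\<lambda>\<omega>. T_hat tb S b s_min s_max \<Delta> n (z \<omega>) (th \<omega>)) \<in> borel_measurable M"
proof -
  have [measurable]: "(\<lambda>\<omega>. block_lrv b (first_block tb S n (th \<omega>)) (z \<omega>)) \<in> borel_measurable M"
    unfolding first_block_eq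
    by (rule measurable_compose_countable[where f = "\<lambda>k \<omega>. block_lrv b {1..k} (z \<omega>)"])
      (auto intro: block_lrv_measurable)
  have [measurable]: "(\<lambda>\<omega>. block_lrv b (second_block tb S n (th \<omega>)) (z \<omega>)) \<in> borel_measurable M"
    unfolding second_block_eq
    by (rule measurable_compose_countable[where f = "\<lambda>k \<omega>. block_lrv b {k + 1..int n} (z \<omega>)"])
      (auto intro: block_lrv_measurable)
  note M_hat_sq_measurable[measurable]
  show ?thesis unfolding T_hat_def lrv_estimate_def tau_def by measurable
qed

lemma max_statistic_measurable:
  assumes "\<And>h j. h \<in> {1..d} \<Longrightarrow> (\<lambda>\<omega>. z \<omega> h j) \<in> borel_measurable M"
    and "\<And>h. h \<in> {1..d} \<Longrightarrow> th h \<in> borel_measurable M"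
  shows "(\<lambda>\<omega>. max_statistic tb S b s_min s_max \<Delta> d n (z \<omega>) (\<lambda>h. th h \<omega>)) \<in> borel_measurable M"
proof -
  have [measurable]: "(\<lambda>\<omega>. MAX h\<in>{1..d}. T_hat tb S b s_min s_max (\<Delta> h) n (z \<omega> h) (th h \<omega>)) \<in> borel_measurable M"
    using assms by (intro borel_measurable_Max T_hat_measurable) auto
  show ?thesis unfolding max_statistic_def by measurable
qed


section \<open>The CUSUM process near a change point\<close>

text \<open>The noiseless CUSUM limit for a unit jump at t: s (1 - t) before t and t (1 - s) after
  it, the covariance function of the Brownian bridge.\<close>

definition tent :: "real \<Rightarrow> real \<Rightarrow> real" where
  "tent t s = min s t - s * t"

text \<open>Rounding n s and n t to integers moves the minimum by at most 1/n and the product by at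
  most 2/n, hence the 3; the noise enters through two normalised partial sums, each at most
  \<eta>.\<close>

lemma cusum_change_point:
  assumes n: "n > 0" and t: "0 < t" "t < 1" and s: "0 \<le> s" "s \<le> 1"
    and z: "\<And>j. z j = (if j \<le> \<lfloor>real n * t\<rfloor> then a else b) + x j"
    and x: "\<And>l. l \<le> int n \<Longrightarrow> \<bar>\<Sum>j=1..l. x j\<bar> \<le> \<eta> * real n"
  shows "\<bar>cusum n z s - (a - b) * tent t s\<bar> \<le> 3 * \<bar>a - b\<bar> / real n + 2 * \<eta>"
proof -
  define m where "m = \<lfloor>real n * t\<rfloor>"
  define k where "k = \<lfloor>real n * s\<rfloor>"
  define X where "X = (\<lambda>l. \<Sum>j=1..l. x j)"
  have m: "0 \<le> m" "m \<le> int n" and k: "0 \<le> k" "k \<le> int n"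
    using t s mult_left_le[of t "real n"] mult_left_le[of s "real n"]
    by (auto simp: m_def k_def floor_le_iff)
  \<comment> \<open>The mean is written as the level b plus a jump a - b on the times up to m; b
    cancels in the CUSUM.\<close>
  have sum_z: "(\<Sum>j=1..l. z j) = b * l + (a - b) * min l m + X l" if "0 \<le> l" for l
  proof -
    have "(\<Sum>j=1..l. z j) = (\<Sum>j=1..l. b + (if j \<in> {..m} then a - b else 0) + x j)"
      by (intro sum.cong) (auto simp: z m_def)
    also have "\<dots> = b * l + (\<Sum>j\<in>{1..l} \<inter> {..m}. a - b) + X l"
      using that by (subst sum.inter_restrict) (simp_all add: sum.distrib X_def)
    also have "{1..l} \<inter> {..m} = {1..min l m}" by auto
    finally show ?thesis using that m by (simp add: mult.commute)
  qed
  define ks where "ks = k / real n"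
  define mt where "mt = m / real n"
  have floor_approx: "\<bar>\<lfloor>real n * r\<rfloor> / n - r\<bar> \<le> 1 / n" for r
  proof -
    have "\<lfloor>real n * r\<rfloor> / n - r = (\<lfloor>real n * r\<rfloor> - real n * r) / n" using n by (simp add: field_simps)
    also have "\<bar>\<dots>\<bar> = \<bar>\<lfloor>real n * r\<rfloor> - real n * r\<bar> / n" by simp
    also have "\<dots> \<le> 1 / n" by (intro divide_right_mono) linarith+
    finally show ?thesis .
  qed
  have approx: "\<bar>ks - s\<bar> \<le> 1 / n" "\<bar>mt - t\<bar> \<le> 1 / n"
    unfolding ks_def mt_def k_def m_def by (rule floor_approx)+
  have range: "0 \<le> ks" "ks \<le> 1" "0 \<le> mt" "mt \<le> 1"
    using k m n by (simp_all add: ks_def mt_def field_simps)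
  have "cusum n z s = (b * k + (a - b) * min k m + X k) / n - k / (real n)\<^sup>2 * (b * n + (a - b) * m + X n)"
    unfolding cusum_def k_def[symmetric] using k m by (simp add: sum_z)
  also have "\<dots> = (a - b) * (min k m / n - ks * mt) + (X k / n - ks * (X n / n))"
    unfolding ks_def mt_def using n by (simp add: field_simps power2_eq_square)
  also have "min k m / real n = min ks mt"
    unfolding ks_def mt_def using n by (auto simp: min_def field_simps)
  finally have *: "cusum n z s - (a - b) * tent t s
      = (a - b) * (tent mt ks - tent t s) + (X k / n - ks * (X n / n))"
    by (simp add: tent_def algebra_simps)
  have "\<bar>ks * mt - s * t\<bar> \<le> 2 * (1 / n)"
  proof -
    have "ks * mt - s * t = ks * (mt - t) + t * (ks - s)" by (simp add: algebra_simps)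
    also have "\<bar>\<dots>\<bar> \<le> ks * \<bar>mt - t\<bar> + t * \<bar>ks - s\<bar>"
      using range t abs_triangle_ineq[of "ks * (mt - t)" "t * (ks - s)"] by (simp add: abs_mult)
    also have "\<dots> \<le> 1 * (1 / n) + 1 * (1 / n)"
      using range t approx by (intro add_mono mult_mono) auto
    finally show ?thesis by simp
  qed
  then have "\<bar>tent mt ks - tent t s\<bar> \<le> 3 * (1 / n)"
    using approx unfolding tent_def by (auto simp: min_def abs_le_iff)
  then have "\<bar>a - b\<bar> * \<bar>tent mt ks - tent t s\<bar> \<le> \<bar>a - b\<bar> * (3 * (1 / n))"
    by (rule mult_left_mono) simp
  then have "\<bar>(a - b) * (tent mt ks - tent t s)\<bar> \<le> 3 * \<bar>a - b\<bar> / real n"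
    by (simp add: abs_mult mult.commute)
  moreover have "\<bar>X k / n\<bar> \<le> \<eta>" "\<bar>X n / n\<bar> \<le> \<eta>"
    using x[of k] x[of n] k n by (simp_all add: X_def field_simps)
  moreover from this have "\<bar>ks * (X n / n)\<bar> \<le> 1 * \<eta>"
    unfolding abs_mult using range by (intro mult_mono) auto
  ultimately show ?thesis unfolding * by linarith
qed

section \<open>Shape of the tent function\<close>

lemma tent_nonneg: "0 \<le> tent t s" and tent_le_1: "tent t s \<le> 1"
  if "0 \<le> t" "t \<le> 1" "0 \<le> s" "s \<le> 1" for t s
  using that mult_left_le[of s t] mult_left_le[of t s] mult_nonneg_nonneg[of s t]
  unfolding tent_def by (simp_all add: min_def mult.commute, linarith+)

text \<open>The slopes 1 - t and -t are at most 1 in absolute value.\<close>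

lemma tent_lipschitz:
  assumes "0 \<le> t" "t \<le> 1"
  shows "\<bar>tent t r - tent t s\<bar> \<le> \<bar>r - s\<bar>"
proof -
  have *: "tent t r - tent t s \<le> s - r \<and> tent t s - tent t r \<le> s - r" if "r \<le> s" for r s
  proof -
    have "0 \<le> t * (s - r)" "t * (s - r) \<le> 1 * (s - r)"
      using assms that by (auto simp only: mult_1_left intro!: mult_nonneg_nonneg mult_left_le_one_le)
    then show ?thesis using that unfolding tent_def by (auto simp: min_def algebra_simps)
  qed
  show ?thesis using *[of r s] *[of s r] by (cases "r \<le> s") auto
qed

text \<open>Both slopes are at least tb in absolute value, so the loss of height is at least linear
  in the distance from the peak.\<close>

lemma tent_peak:
  assumes "tb \<le> t" "t \<le> 1 - tb"
  shows "tb * \<bar>s - t\<bar> \<le> tent t t - tent t s"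
proof (cases "s \<le> t")
  case True
  then have "tb * (t - s) \<le> (1 - t) * (t - s)" using assms by (intro mult_right_mono) auto
  then show ?thesis using True by (simp add: tent_def min_def algebra_simps)
next
  case False
  then have "tb * (s - t) \<le> t * (s - t)" using assms by (intro mult_right_mono) auto
  then show ?thesis using False by (simp add: tent_def min_def algebra_simps)
qed

text \<open>Integrated on either side of the kink. The value explains the normalisation 3 / (t (1 -
  t))^2 of the estimated squared jump.\<close>

lemma has_integral_tent_sq:
  assumes "0 \<le> t" "t \<le> 1"
  shows "((\<lambda>s. (tent t s)\<^sup>2) has_integral (t * (1 - t))\<^sup>2 / 3) {0..1}"
proof -
  have "((\<lambda>s. (s * (1 - t))\<^sup>2) has_integral (t ^ 3 / 3 * (1 - t)\<^sup>2 - 0 ^ 3 / 3 * (1 - t)\<^sup>2)) {0..t}"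
    using assms by (intro fundamental_theorem_of_calculus)
      (auto intro!: derivative_eq_intros simp: power2_eq_square simp flip: has_real_derivative_iff_has_vector_derivative)
  then have "((\<lambda>s. (tent t s)\<^sup>2) has_integral (t ^ 3 / 3 * (1 - t)\<^sup>2 - 0 ^ 3 / 3 * (1 - t)\<^sup>2)) {0..t}"
    by (rule has_integral_eq[rotated]) (auto simp: tent_def algebra_simps)
  then have 1: "((\<lambda>s. (tent t s)\<^sup>2) has_integral (t ^ 3 / 3 * (1 - t)\<^sup>2)) {0..t}" by simp
  have "((\<lambda>s. (t * (1 - s))\<^sup>2) has_integral (- ((1 - 1) ^ 3 / 3 * t\<^sup>2) - - ((1 - t) ^ 3 / 3 * t\<^sup>2))) {t..1}"
    using assms by (intro fundamental_theorem_of_calculus)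
      (auto intro!: derivative_eq_intros simp: power2_eq_square simp flip: has_real_derivative_iff_has_vector_derivative)
  then have "((\<lambda>s. (tent t s)\<^sup>2) has_integral (- ((1 - 1) ^ 3 / 3 * t\<^sup>2) - - ((1 - t) ^ 3 / 3 * t\<^sup>2))) {t..1}"
    by (rule has_integral_eq[rotated]) (auto simp: tent_def min_def algebra_simps)
  then have 2: "((\<lambda>s. (tent t s)\<^sup>2) has_integral ((1 - t) ^ 3 / 3 * t\<^sup>2)) {t..1}" by simp
  have "((\<lambda>s. (tent t s)\<^sup>2) has_integral (t ^ 3 / 3 * (1 - t)\<^sup>2 + (1 - t) ^ 3 / 3 * t\<^sup>2)) {0..1}"
    using assms 1 2 by (intro has_integral_combine) auto
  also have "t ^ 3 / 3 * (1 - t)\<^sup>2 + (1 - t) ^ 3 / 3 * t\<^sup>2 = (t * (1 - t))\<^sup>2 / 3"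
    by (simp add: power2_eq_square power3_eq_cube field_simps)
  finally show ?thesis .
qed

text \<open>At the maximiser the process is no smaller than at points near t. With an error \<kappa>
  on each side of the comparison, the tent at \<open>th\<close> is within 2 \<kappa> / |D| of its
  peak, and \<open>tent_peak\<close> converts this into a distance.\<close>

lemma change_point_estimate_close:
  assumes D: "D \<noteq> 0" and tb: "0 < tb" "tb < 1 / 2" and t: "tb \<le> t" "t \<le> 1 - tb"
    and approx: "\<And>s. 0 \<le> s \<Longrightarrow> s \<le> 1 \<Longrightarrow> \<bar>cusum n z s - D * tent t s\<bar> \<le> \<kappa>"
    and th: "is_change_point_estimate tb n z th"
  shows "\<bar>th - t\<bar> \<le> 2 * \<kappa> / (\<bar>D\<bar> * tb)"
proof -
  have t01: "0 \<le> t" "t \<le> 1" using t tb by auto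
  have th_in: "tb < th" "th < 1 - tb" and
    max: "\<And>s. tb < s \<Longrightarrow> s < 1 - tb \<Longrightarrow> \<bar>cusum n z s\<bar> \<le> \<bar>cusum n z th\<bar>"
    using th by (auto simp: is_change_point_estimate_def is_arg_max_def not_less) (meson not_less)
  have abs_tent: "\<bar>D * tent t s\<bar> = \<bar>D\<bar> * tent t s" if "0 \<le> s" "s \<le> 1" for s
    using tent_nonneg[OF t01 that] by (simp add: abs_mult)
  have "\<bar>D\<bar> * tent t t \<le> \<bar>D\<bar> * tent t th + 2 * \<kappa>"
  proof (rule field_le_epsilon)
    fix e :: real assume e: "e > 0"
    \<comment> \<open>The peak t may be an endpoint of the open search interval, so t is moved
      inwards by e'. The first term keeps the loss below e, the second keeps the new point
      inside.\<close>
    define e' where "e' = min (e / \<bar>D\<bar>) ((1 - 2 * tb) / 3)"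
    have e': "e' > 0" "e' \<le> e / \<bar>D\<bar>" "e' < (1 - 2 * tb) / 2" using e D tb by (auto simp: e'_def min_def)
    obtain s where s: "tb < s" "s < 1 - tb" "\<bar>t - s\<bar> \<le> e'"
    proof (cases "t \<le> 1 / 2")
      case True
      then show ?thesis using that[of "t + e'"] e' t by auto
    next
      case False
      then show ?thesis using that[of "t - e'"] e' t by auto
    qed
    have "\<bar>D\<bar> * (tent t t - tent t s) \<le> \<bar>D\<bar> * (e / \<bar>D\<bar>)"
      using tent_lipschitz[OF t01, of t s] s e' by (intro mult_left_mono) auto
    then have "\<bar>D\<bar> * tent t t \<le> \<bar>D\<bar> * tent t s + e"
      using D by (simp add: right_diff_distrib)
    moreover have "\<bar>D\<bar> * tent t s \<le> \<bar>cusum n z s\<bar> + \<kappa>"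
      using abs_tent[of s] approx[of s] s tb by linarith
    moreover have "\<bar>cusum n z th\<bar> \<le> \<bar>D\<bar> * tent t th + \<kappa>"
      using abs_tent[of th] approx[of th] th_in tb by linarith
    ultimately show "\<bar>D\<bar> * tent t t \<le> \<bar>D\<bar> * tent t th + 2 * \<kappa> + e"
      using max[OF s(1,2)] by linarith
  qed
  moreover have "\<bar>D\<bar> * (tb * \<bar>th - t\<bar>) \<le> \<bar>D\<bar> * (tent t t - tent t th)"
    by (intro mult_left_mono tent_peak t) simp
  ultimately have "\<bar>D\<bar> * tb * \<bar>th - t\<bar> \<le> 2 * \<kappa>" by (simp add: algebra_simps)
  then show ?thesis using D tb by (simp add: field_simps)
qed

text \<open>Numerator: the square of the process is at least (D tent)^2 - 2 |D| \<kappa>, which is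
  integrated and multiplied by 3. Denominator: the estimate is close to t. By \<open>pos\<close> the
  lower bound for the numerator is nonnegative.\<close>

lemma M_hat_sq_lower_bound:
  assumes D: "D \<noteq> 0" and tb: "0 < tb" "tb < 1 / 2" and t: "tb \<le> t" "t \<le> 1 - tb" and \<kappa>: "\<kappa> \<ge> 0"
    and approx: "\<And>s. 0 \<le> s \<Longrightarrow> s \<le> 1 \<Longrightarrow> \<bar>cusum n z s - D * tent t s\<bar> \<le> \<kappa>"
    and th: "is_change_point_estimate tb n z th"
    and pos: "6 * \<bar>D\<bar> * \<kappa> \<le> (D * (t * (1 - t)))\<^sup>2"
  shows "((D * (t * (1 - t)))\<^sup>2 - 6 * \<bar>D\<bar> * \<kappa>) / (t * (1 - t) + 2 * \<kappa> / (\<bar>D\<bar> * tb))\<^sup>2 \<le> M_hat_sq n z th"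
proof -
  have t01: "0 \<le> t" "t \<le> 1" using t tb by auto
  have th_in: "tb < th" "th < 1 - tb"
    using th by (auto simp: is_change_point_estimate_def is_arg_max_def)
  have close: "\<bar>th - t\<bar> \<le> 2 * \<kappa> / (\<bar>D\<bar> * tb)"
    using change_point_estimate_close[OF D tb t approx th] by simp
  have "D\<^sup>2 * ((t * (1 - t))\<^sup>2 / 3) - 2 * \<bar>D\<bar> * \<kappa> \<le> integral {0..1} (\<lambda>s. (cusum n z s)\<^sup>2)"
  proof (rule has_integral_le)
    show "((\<lambda>s. D\<^sup>2 * (tent t s)\<^sup>2 - 2 * \<bar>D\<bar> * \<kappa>) has_integral D\<^sup>2 * ((t * (1 - t))\<^sup>2 / 3) - 2 * \<bar>D\<bar> * \<kappa>) {0..1}"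
      using has_integral_const_real[of "2 * \<bar>D\<bar> * \<kappa>" 0 1]
      by (intro has_integral_diff has_integral_mult_right[OF has_integral_tent_sq] t01) simp
    show "((\<lambda>s. (cusum n z s)\<^sup>2) has_integral integral {0..1} (\<lambda>s. (cusum n z s)\<^sup>2)) {0..1}"
      using integrable_on_cusum_sq by (rule integrable_integral)
    fix s :: real assume "s \<in> {0..1}"
    then have s: "0 \<le> s" "s \<le> 1" by auto
    let ?e = "cusum n z s - D * tent t s"
    have "\<bar>D * tent t s * ?e\<bar> = \<bar>D\<bar> * (tent t s * \<bar>?e\<bar>)"
      using tent_nonneg[OF t01 s] by (simp add: abs_mult)
    also have "\<dots> \<le> \<bar>D\<bar> * (1 * \<kappa>)"
      using tent_nonneg[OF t01 s] tent_le_1[OF t01 s] approx[OF s] by (intro mult_left_mono mult_mono) auto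
    finally have "- (D * tent t s * ?e) \<le> \<bar>D\<bar> * \<kappa>" by simp
    moreover have "(cusum n z s)\<^sup>2 = (D * tent t s)\<^sup>2 + 2 * (D * tent t s * ?e) + ?e\<^sup>2"
      by (simp add: power2_eq_square algebra_simps)
    ultimately show "D\<^sup>2 * (tent t s)\<^sup>2 - 2 * \<bar>D\<bar> * \<kappa> \<le> (cusum n z s)\<^sup>2"
      using zero_le_power2[of ?e] unfolding power_mult_distrib by linarith
  qed
  then have num: "(D * (t * (1 - t)))\<^sup>2 - 6 * \<bar>D\<bar> * \<kappa> \<le> 3 * integral {0..1} (\<lambda>s. (cusum n z s)\<^sup>2)"
    by (simp add: power_mult_distrib)
  \<comment> \<open>On the diagonal \<open>tent u u\<close> is u (1 - u), which is the quantity in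
    the denominator.\<close>
  have "tent th th - tent t t \<le> \<bar>th - t\<bar>"
  proof -
    have "tent th th - tent t t = (th - t) * (1 - th - t)" by (simp add: tent_def algebra_simps)
    also have "\<dots> \<le> \<bar>th - t\<bar> * \<bar>1 - th - t\<bar>" by (simp flip: abs_mult)
    also have "\<dots> \<le> \<bar>th - t\<bar> * 1" using th_in t01 tb by (intro mult_left_mono) auto
    finally show ?thesis by simp
  qed
  then have den: "th * (1 - th) \<le> t * (1 - t) + 2 * \<kappa> / (\<bar>D\<bar> * tb)"
    using close by (simp add: tent_def algebra_simps)
  have "0 < th * (1 - th)" using th_in tb by simp
  then have "((D * (t * (1 - t)))\<^sup>2 - 6 * \<bar>D\<bar> * \<kappa>) / (t * (1 - t) + 2 * \<kappa> / (\<bar>D\<bar> * tb))\<^sup>2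
      \<le> (3 * integral {0..1} (\<lambda>s. (cusum n z s)\<^sup>2)) / (th * (1 - th))\<^sup>2"
    using num den pos by (intro frac_le power_mono) auto
  then show ?thesis by (simp add: M_hat_sq_def)
qed

text \<open>The preceding lower bound tends to D^2 as \<kappa> decreases to 0. The \<kappa> obtained
  is the same for all n and all data.\<close>

lemma M_hat_sq_exceeds:
  assumes D: "D \<noteq> 0" and tb: "0 < tb" "tb < 1 / 2" and t: "tb \<le> t" "t \<le> 1 - tb" and c: "c < D\<^sup>2"
  obtains \<kappa> where "\<kappa> > 0"
    "\<And>n z th. (\<And>s. 0 \<le> s \<Longrightarrow> s \<le> 1 \<Longrightarrow> \<bar>cusum n z s - D * tent t s\<bar> \<le> \<kappa>) \<Longrightarrow>
       is_change_point_estimate tb n z th \<Longrightarrow> c \<le> M_hat_sq n z th"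
proof -
  let ?F = "\<lambda>\<kappa>. ((D * (t * (1 - t)))\<^sup>2 - 6 * \<bar>D\<bar> * \<kappa>) / (t * (1 - t) + 2 * \<kappa> / (\<bar>D\<bar> * tb))\<^sup>2"
  have v: "0 < t * (1 - t)" using t tb by simp
  have Dtb: "\<bar>D\<bar> * tb \<noteq> 0" using D tb by simp
  have v0: "(t * (1 - t) + 2 * 0 / (\<bar>D\<bar> * tb))\<^sup>2 \<noteq> 0" using t tb by simp
  have "(?F \<longlongrightarrow> ?F 0) (at_right 0)"
    by (intro tendsto_intros Dtb v0)
  moreover have "?F 0 = D\<^sup>2" using v by (auto simp: power_mult_distrib)
  ultimately have "(?F \<longlongrightarrow> D\<^sup>2) (at_right 0)" by simp
  then have "\<forall>\<^sub>F \<kappa> in at_right 0. c < ?F \<kappa>" using c by (rule order_tendstoD(1))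
  moreover have "((\<lambda>\<kappa>. 6 * \<bar>D\<bar> * \<kappa>) \<longlongrightarrow> 6 * \<bar>D\<bar> * 0) (at_right 0)"
    by (intro tendsto_intros)
  then have "\<forall>\<^sub>F \<kappa> in at_right 0. 6 * \<bar>D\<bar> * \<kappa> < (D * (t * (1 - t)))\<^sup>2"
    using D v by (intro order_tendstoD(2)) auto
  moreover have "\<forall>\<^sub>F \<kappa> in at_right 0. (0::real) < \<kappa>" by (simp add: eventually_at_right_less)
  ultimately have "\<forall>\<^sub>F \<kappa> in at_right 0. c < ?F \<kappa> \<and> 6 * \<bar>D\<bar> * \<kappa> < (D * (t * (1 - t)))\<^sup>2 \<and> 0 < \<kappa>"
    by eventually_elim simp
  then obtain \<kappa> where \<kappa>: "c < ?F \<kappa>" "6 * \<bar>D\<bar> * \<kappa> < (D * (t * (1 - t)))\<^sup>2" "0 < \<kappa>"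
    using eventually_happens'[OF trivial_limit_at_right_real] by blast
  show ?thesis
  proof (rule that[OF \<kappa>(3)])
    fix n z th
    assume "\<And>s. 0 \<le> s \<Longrightarrow> s \<le> 1 \<Longrightarrow> \<bar>cusum n z s - D * tent t s\<bar> \<le> \<kappa>" "is_change_point_estimate tb n z th"
    from M_hat_sq_lower_bound[OF D tb t _ this] \<kappa> show "c \<le> M_hat_sq n z th" by linarith
  qed
qed

section \<open>Lower bound for the studentised statistic\<close>

lemma tau_pos: "0 < tau t" and tau_le: "tau t \<le> 4 / tb\<^sup>2"
  if "0 < tb" "tb < t" "t < 1 - tb"
proof -
  have pos: "0 < t * (1 - t)" and "tb * tb \<le> t * (1 - t)"
    using that by (auto intro!: mult_mono)
  then have "0 < 1 + 2 * (t * (1 - t))" by linarith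
  with pos show "0 < tau t" unfolding tau_def by (simp add: mult.assoc)
  have "0 \<le> (2 * t - 1)\<^sup>2" by simp
  then have "2 * t * (1 - t) \<le> 1" by (simp add: power2_eq_square algebra_simps)
  then have s1: "sqrt (1 + 2 * t * (1 - t)) \<le> 2" by (intro real_le_lsqrt) auto
  have s2: "(1::real) \<le> sqrt 5" by simp
  have "1 * tb\<^sup>2 \<le> sqrt 5 * (t * (1 - t))"
    unfolding power2_eq_square using s2 \<open>tb * tb \<le> _\<close> by (rule mult_mono) auto
  then have "2 * sqrt (1 + 2 * t * (1 - t)) / (sqrt 5 * (t * (1 - t))) \<le> 4 / tb\<^sup>2"
    using s1 that by (intro frac_le) auto
  then show "tau t \<le> 4 / tb\<^sup>2" by (simp add: tau_def mult.assoc)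
qed

text \<open>Clipping confines the estimated long-run standard deviation to [s_min, s_max] and
  trimming bounds \<open>tau\<close>, so the normalisation is at most 4 s_max \<Delta> / tb^2 on
  every path.\<close>

lemma T_hat_lower_bound:
  assumes th: "0 < tb" "tb < th" "th < 1 - tb" and s: "0 < s_min" "s_min \<le> s_max" and \<Delta>: "0 < \<Delta>"
    and r: "0 \<le> r" "\<Delta>\<^sup>2 + r \<le> M_hat_sq n z th"
  shows "sqrt (real n) * (r * tb\<^sup>2 / (4 * s_max * \<Delta>)) \<le> T_hat tb S b s_min s_max \<Delta> n z th"
proof -
  let ?v = "lrv_estimate tb S b s_min s_max n z th"
  have "s_min\<^sup>2 \<le> s_max\<^sup>2" using s by simp
  then have v: "s_min\<^sup>2 \<le> ?v" "?v \<le> s_max\<^sup>2" by (auto simp: lrv_estimate_def)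
  have v0: "0 < sqrt ?v" using v s by (intro real_sqrt_gt_zero) (auto intro: less_le_trans[of _ "s_min\<^sup>2"])
  have v1: "sqrt ?v \<le> s_max" using v s by (intro real_le_lsqrt) auto
  have "tau th * sqrt ?v * \<Delta> \<le> 4 / tb\<^sup>2 * s_max * \<Delta>"
    using tau_pos[OF th] tau_le[OF th] v0 v1 \<Delta> s by (intro mult_mono) auto
  then have "sqrt n / (4 / tb\<^sup>2 * s_max * \<Delta>) \<le> sqrt n / (tau th * sqrt ?v * \<Delta>)"
    using tau_pos[OF th] v0 \<Delta> by (intro divide_left_mono mult_pos_pos) (use th s in auto)
  then have "sqrt n / (4 / tb\<^sup>2 * s_max * \<Delta>) * r
      \<le> sqrt n / (tau th * sqrt ?v * \<Delta>) * (M_hat_sq n z th - \<Delta>\<^sup>2)"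
    using r tau_pos[OF th] v0 \<Delta> by (intro mult_mono) auto
  then show ?thesis using th by (simp add: T_hat_def mult_ac)
qed


section \<open>Consistency of the test\<close>

text \<open>The squared scale 2 ln d is o(n), so scale and centring both fall below (c / 2) sqrt n.
  The bracket is then at least 1, and the scale alone exceeds K.\<close>

lemma gumbel_centre_negligible:
  assumes d: "filterlim d at_top sequentially" and small: "(\<lambda>n. ln (real (d n))) \<in> o(\<lambda>n. real n)"
    and c: "c > 0"
  shows "\<forall>\<^sub>F n in sequentially. K < gumbel_scale (d n) * (sqrt (real n) * c - gumbel_centre (d n))"
proof -
  have ln_d: "filterlim (\<lambda>n. ln (real (d n))) at_top sequentially"
    by (intro filterlim_compose[OF ln_at_top] filterlim_compose[OF filterlim_real_sequentially] d)
  \<comment> \<open>The factor c^2 / 8 yields 2 ln d \<le> (c / 2)^2 n.\<close>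
  have "\<forall>\<^sub>F n in sequentially. norm (ln (real (d n))) \<le> (c\<^sup>2 / 8) * norm (real n)"
    using small c by (intro landau_o.smallD) auto
  \<comment> \<open>This yields a scale above K and also ln d \<ge> 1, so that the iterated
    logarithm in the centring is nonnegative and the centring is at most the scale.\<close>
  moreover have "\<forall>\<^sub>F n in sequentially. (\<bar>K\<bar> + 1)\<^sup>2 + 1 \<le> ln (real (d n))"
    using ln_d by (simp add: filterlim_at_top)
  moreover have "\<forall>\<^sub>F n in sequentially. (2 / c)\<^sup>2 \<le> real n"
    using filterlim_real_sequentially by (simp add: filterlim_at_top)
  ultimately show ?thesis
  proof eventually_elim
    case (elim n)
    define a where "a = gumbel_scale (d n)"
    have ln1: "1 \<le> ln (real (d n))" using elim(2) zero_le_power2[of "\<bar>K\<bar> + 1"] by linarith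
    have "(\<bar>K\<bar> + 1)\<^sup>2 \<le> 2 * ln (real (d n))" using elim(2) ln1 by linarith
    then have aK: "\<bar>K\<bar> + 1 \<le> a" unfolding a_def gumbel_scale_def by (rule real_le_rsqrt)
    have "1 * 1 \<le> 4 * pi * ln (real (d n))" using ln1 pi_ge_two by (intro mult_mono) auto
    then have "0 \<le> ln (4 * pi * ln (real (d n)))" by (intro ln_ge_zero) simp
    then have b: "gumbel_centre (d n) \<le> a"
      using aK unfolding gumbel_centre_def a_def by simp
    have "2 * ln (real (d n)) \<le> (c / 2)\<^sup>2 * real n"
      using elim(1) ln1 by (simp add: power2_eq_square)
    then have "a \<le> sqrt ((c / 2)\<^sup>2 * real n)" unfolding a_def gumbel_scale_def by (rule real_sqrt_le_mono)
    also have "\<dots> = c / 2 * sqrt n" using c by (simp add: real_sqrt_mult)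
    finally have a: "a \<le> c / 2 * sqrt n" .
    have "2 / c \<le> sqrt n" using elim(3) by (rule real_le_rsqrt)
    then have "1 \<le> c / 2 * sqrt n" using c by (simp add: field_simps)
    then have "1 \<le> sqrt n * c - gumbel_centre (d n)" using a b by (simp add: mult.commute)
    then have "a * 1 \<le> a * (sqrt n * c - gumbel_centre (d n))" using aK by (intro mult_left_mono) auto
    then show ?case using aK unfolding a_def by linarith
  qed
qed

text \<open>The joint limit is taken along a dimension sequence \<open>d n\<close>, whose logarithm
  is o(n) so that the drift of order sqrt n outgrows the centring. As the maximiser is not unique,
  \<open>t_hat\<close> stands for any measurable selection of maximisers.\<close>

theorem theorem4p3:
  fixes M :: "'a measure" and N :: "'s measure"
    and \<epsilon> :: "int \<Rightarrow> 'a \<Rightarrow> 's" and \<epsilon>' :: "'a \<Rightarrow> 's"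
    and g :: "nat \<Rightarrow> (nat \<Rightarrow> 's) \<Rightarrow> real"
    and \<mu>1 \<mu>2 t \<Delta> :: "nat \<Rightarrow> real"
    and d :: "nat \<Rightarrow> nat"
    and p \<delta> \<sigma>_min \<sigma>_max tb S B s_min s_max :: real
    and \<beta> :: "nat \<Rightarrow> real"
    and t_hat :: "nat \<Rightarrow> nat \<Rightarrow> 'a \<Rightarrow> real"
  defines "Z \<equiv> observation g \<epsilon> \<mu>1 \<mu>2 t"
  defines "T \<equiv> \<lambda>n \<omega>. max_statistic tb S (\<beta> n) s_min s_max \<Delta> (d n) n (Z n \<omega>) (\<lambda>h. t_hat n h \<omega>)"
  assumes "prob_space M"
    \<comment> \<open>i.i.d. innovations and an independent copy of the innovation at time 0\<close>
    and "prob_space.indep_vars M (\<lambda>_. N) (case_option \<epsilon>' \<epsilon>) UNIV"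
    and "\<And>j. distr M N (\<epsilon> j) = distr M N (\<epsilon> 0)"
    and "distr M N \<epsilon>' = distr M N (\<epsilon> 0)"
    \<comment> \<open>measurable filters and centred noise\<close>
    and "\<And>h. h \<ge> 1 \<Longrightarrow> g h \<in> borel_measurable (Pi\<^sub>M UNIV (\<lambda>_. N))"
    and "\<And>j h. h \<ge> 1 \<Longrightarrow> integrable M (noise g \<epsilon> j h)"
    and "\<And>j h. h \<ge> 1 \<Longrightarrow> (\<integral>\<omega>. noise g \<epsilon> j h \<omega> \<partial>M) = 0"
    \<comment> \<open>change points, thresholds and dimension\<close>
    and "\<And>h. h \<ge> 1 \<Longrightarrow> 0 < t h \<and> t h < 1"
    and "\<And>h. h \<ge> 1 \<Longrightarrow> \<mu>1 h - \<mu>2 h = 0 \<Longrightarrow> t h = 1 / 2"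
    and "\<And>h. h \<ge> 1 \<Longrightarrow> \<Delta> h > 0"
    and "filterlim d at_top sequentially"
    and "(\<lambda>n. ln (real (d n))) \<in> o(\<lambda>n. real n)"
    \<comment> \<open>(T1)\<close>
    and "p > 4" and "0 < \<delta>" and "\<delta> < 1"
    and "geometric_dependence M g \<epsilon> \<epsilon>' p \<delta>"
    \<comment> \<open>(T2)\<close>
    and "\<sigma>_min > 0" and "\<sigma>_max > 0"
    and "\<And>h. h \<ge> 1 \<Longrightarrow> \<sigma>_min \<le> long_run_sd M g \<epsilon> h \<and> long_run_sd M g \<epsilon> h \<le> \<sigma>_max"
    \<comment> \<open>(C1)\<close>
    and "0 < tb" and "tb < 1 / 2"
    and "\<And>h. h \<ge> 1 \<Longrightarrow> tb \<le> t h \<and> t h \<le> 1 - tb"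
    \<comment> \<open>tuning parameters of the long-run variance estimator\<close>
    and "0 < S" and "S < 1"
    and "0 < B" and "B < 1 / 2"
    and "asymp_equiv \<beta> sequentially (\<lambda>n. real n powr B)"
    and "0 < s_min" and "s_min \<le> s_max"
    \<comment> \<open>change point estimators\<close>
    and "\<And>n h. h \<in> {1..d n} \<Longrightarrow> t_hat n h \<in> borel_measurable M"
    and "\<And>n h \<omega>. h \<in> {1..d n} \<Longrightarrow> \<omega> \<in> space M \<Longrightarrow>
           is_change_point_estimate tb n (Z n \<omega> h) (t_hat n h \<omega>)"
    \<comment> \<open>the alternative hypothesis\<close>
    and "\<forall>\<^sub>F n in sequentially. \<exists>h\<in>{1..d n}. \<bar>\<mu>1 h - \<mu>2 h\<bar> > \<Delta> h"
  shows "tends_to_infinity_in_prob M T \<and>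
         (\<forall>\<alpha>\<in>{0<..<1}. (\<lambda>n. measure M {\<omega> \<in> space M. T n \<omega> > gumbel_quantile (1 - \<alpha>)}) \<longlonglongrightarrow> 1)"
proof -
  note Z_def = assms(1) and T_def = assms(2)
  interpret prob_space M by fact
  \<comment> \<open>Restriction along \<open>Some\<close> leaves the innovations without the
    independent copy.\<close>
  have "indep_vars (\<lambda>_. N) (\<lambda>k. case_option \<epsilon>' \<epsilon> (Some k)) UNIV"
    by (rule indep_vars_reindex[OF assms(4)]) auto
  then interpret iid_innovations M N \<epsilon>
    using assms(5) by unfold_locales simp_all
  have noise: "noise g \<epsilon> j h = (\<lambda>\<omega>. g h (past j \<omega>))" for j h
    by (simp add: noise_def past_def fun_eq_iff)

  \<comment> \<open>A component found at a single n is relevant for good, as neither its means nor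
    its threshold depend on n.\<close>
  have "\<exists>n. \<exists>h\<in>{1..d n}. \<Delta> h < \<bar>\<mu>1 h - \<mu>2 h\<bar>"
    using assms(34) by (rule eventually_happens'[OF sequentially_bot])
  then obtain h where h: "h \<ge> 1" "\<Delta> h < \<bar>\<mu>1 h - \<mu>2 h\<bar>" by auto
  define D where "D = \<mu>1 h - \<mu>2 h"
  have \<Delta>: "0 < \<Delta> h" using assms(12) h by blast
  have "(\<Delta> h)\<^sup>2 < \<bar>D\<bar>\<^sup>2"
    using h(2) \<Delta> unfolding D_def by (intro power_strict_mono) auto
  then have D: "D \<noteq> 0" "(\<Delta> h)\<^sup>2 < D\<^sup>2" using h(2) \<Delta> by (auto simp: D_def)
  \<comment> \<open>Half the gap, so that the target \<open>(\<Delta> h)\<^sup>2 + r\<close> stays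
    strictly below \<open>D\<^sup>2\<close>.\<close>
  define r where "r = (D\<^sup>2 - (\<Delta> h)\<^sup>2) / 2"
  have r: "0 < r" "(\<Delta> h)\<^sup>2 + r < D\<^sup>2" using D(2) by (simp_all add: r_def field_simps)
  have tb: "0 < tb" "tb < 1 / 2" by fact+
  have th: "tb \<le> t h" "t h \<le> 1 - tb" using h assms(24) by auto
  obtain \<kappa> where \<kappa>: "\<kappa> > 0"
    and M_hat: "\<And>n z s0. (\<And>s. 0 \<le> s \<Longrightarrow> s \<le> 1 \<Longrightarrow> \<bar>cusum n z s - D * tent (t h) s\<bar> \<le> \<kappa>) \<Longrightarrow>
       is_change_point_estimate tb n z s0 \<Longrightarrow> (\<Delta> h)\<^sup>2 + r \<le> M_hat_sq n z s0"
    using M_hat_sq_exceeds[OF D(1) tb th r(2)] by metis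
  \<comment> \<open>The noise error 2 \<eta> uses up one half of \<kappa>; the other half absorbs
    the rounding error 3 |D| / n once n \<ge> 6 |D| / \<kappa>.\<close>
  define \<eta> where "\<eta> = \<kappa> / 4"
  have \<eta>: "\<eta> > 0" using \<kappa> by (simp add: \<eta>_def)
  define c where "c = r * tb\<^sup>2 / (4 * s_max * \<Delta> h)"
  have c: "c > 0" using r \<Delta> tb \<open>0 < s_min\<close> \<open>s_min \<le> s_max\<close> by (simp add: c_def)

  have g: "g h \<in> borel_measurable past_law"
    using assms(7)[OF h(1)] by (simp add: measurable_cong_sets[OF sets_past_law refl])
  have "integrable (distr M past_law (past 0)) (g h)"
    using assms(8)[OF h(1), of 0] g by (subst integrable_distr_eq) (auto simp: noise)
  then have int_g: "integrable past_law (g h)" by (simp add: distr_past)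
  have "(\<integral>x. g h x \<partial>past_law) = 0"
    using expectation_past[OF int_g, of 0] assms(9)[OF h(1), of 0] by (simp add: noise)
  \<comment> \<open>The noise is already centred, so the law of large numbers applies to it as it
    stands.\<close>
  then have "centred (g h) = (\<lambda>j. noise g \<epsilon> j h)"
    by (simp add: centred_def noise fun_eq_iff)
  then have lln: "uniform_lln M (\<lambda>j. noise g \<epsilon> j h)"
    using uniform_lln_integrable[OF int_g] by simp

  have T_meas: "T n \<in> borel_measurable M" for n
  proof -
    have "(\<lambda>\<omega>. Z n \<omega> i j) \<in> borel_measurable M" if "i \<in> {1..d n}" for i j
      using assms(8)[of i j] that unfolding Z_def observation_def by auto
    then show ?thesis
      unfolding T_def by (intro max_statistic_measurable assms(32))
  qed

  have large: "\<forall>\<^sub>F n in sequentially. 1 - e \<le> prob {\<omega>\<in>space M. T n \<omega> > K}" if e: "e > 0" for e K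
  proof -
    have "\<forall>\<^sub>F n in sequentially. h \<le> d n"
      using assms(13) by (simp add: filterlim_at_top)
    moreover have "\<forall>\<^sub>F n::nat in sequentially. 6 * \<bar>D\<bar> / \<kappa> + 1 \<le> real n"
      using filterlim_real_sequentially by (simp add: filterlim_at_top)
    moreover note gumbel_centre_negligible[OF assms(13,14) c, of K]
    \<comment> \<open>At level \<eta> e, Markov's inequality bounds the probability of W \<ge>
      \<eta> n by e.\<close>
    moreover have "\<eta> * e > 0" using \<eta> e by simp
    note lln[unfolded uniform_lln_def, rule_format, OF this]
    ultimately show ?thesis
    proof eventually_elim
      case (elim n)
      from elim(4) obtain W where W: "integrable M W"
        and le: "\<forall>\<omega>\<in>space M. \<forall>l\<le>int n. \<bar>\<Sum>j=1..l. noise g \<epsilon> j h \<omega>\<bar> \<le> W \<omega>"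
        and exp_W: "expectation W \<le> \<eta> * e * real n"
        by blast
      have "0 \<le> 6 * \<bar>D\<bar> / \<kappa>" using \<kappa> by simp
      then have n: "n > 0" using elim(2) by linarith
      have "6 * \<bar>D\<bar> / \<kappa> \<le> n" using elim(2) by linarith
      then have n\<kappa>: "3 * \<bar>D\<bar> / n + 2 * \<eta> \<le> \<kappa>" using n \<kappa> by (simp add: \<eta>_def field_simps)
      have T_large: "T n \<omega> > K" if \<omega>: "\<omega> \<in> space M" and W_small: "W \<omega> < \<eta> * n" for \<omega>
      proof -
        have hd: "h \<in> {1..d n}" using h(1) elim(1) by simp
        have est: "is_change_point_estimate tb n (Z n \<omega> h) (t_hat n h \<omega>)"
          using assms(33)[OF hd \<omega>] .
        then have range: "tb < t_hat n h \<omega>" "t_hat n h \<omega> < 1 - tb"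
          by (auto simp: is_change_point_estimate_def is_arg_max_def)
        have "\<bar>cusum n (Z n \<omega> h) s - D * tent (t h) s\<bar> \<le> \<kappa>" if "0 \<le> s" "s \<le> 1" for s
        proof -
          have "\<bar>cusum n (Z n \<omega> h) s - (\<mu>1 h - \<mu>2 h) * tent (t h) s\<bar>
              \<le> 3 * \<bar>\<mu>1 h - \<mu>2 h\<bar> / real n + 2 * \<eta>"
          proof (rule cusum_change_point[where x = "\<lambda>j. noise g \<epsilon> j h \<omega>"])
            fix l assume "l \<le> int n"
            then show "\<bar>\<Sum>j=1..l. noise g \<epsilon> j h \<omega>\<bar> \<le> \<eta> * real n" using le \<omega> W_small by force
          qed (use n tb th that in \<open>auto simp: Z_def observation_def mean_function_def\<close>)
          then show ?thesis using n\<kappa> by (simp add: D_def)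
        qed
        from M_hat[OF this est] have "(\<Delta> h)\<^sup>2 + r \<le> M_hat_sq n (Z n \<omega> h) (t_hat n h \<omega>)" .
        then have "sqrt n * c \<le> T_hat tb S (\<beta> n) s_min s_max (\<Delta> h) n (Z n \<omega> h) (t_hat n h \<omega>)"
          unfolding c_def using tb range \<open>0 < s_min\<close> \<open>s_min \<le> s_max\<close> \<Delta> r
          by (intro T_hat_lower_bound) auto
        also have "\<dots> \<le> (MAX i\<in>{1..d n}. T_hat tb S (\<beta> n) s_min s_max (\<Delta> i) n (Z n \<omega> i) (t_hat n i \<omega>))"
          using hd by (intro Max_ge) auto
        \<comment> \<open>Since d n \<ge> h \<ge> 1, the logarithm and with it the scale are
          nonnegative.\<close>
        finally have "gumbel_scale (d n) * (sqrt n * c - gumbel_centre (d n)) \<le> T n \<omega>"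
          unfolding T_def max_statistic_def using h(1) elim(1)
          by (intro mult_left_mono) (auto simp: gumbel_scale_def)
        then show ?thesis using elim(3) by linarith
      qed
      \<comment> \<open>The empty partial sum l = 0 is among those that W dominates.\<close>
      have W_nonneg: "0 \<le> W \<omega>" if "\<omega> \<in> space M" for \<omega>
        using le that by (force dest: bspec spec[of _ 0])
      have [measurable]: "W \<in> borel_measurable M" "T n \<in> borel_measurable M" using W T_meas by auto
      have "prob {\<omega>\<in>space M. \<eta> * n \<le> W \<omega>} \<le> expectation W / (\<eta> * n)"
        using W W_nonneg \<eta> n by (intro integral_Markov_inequality_measure[where A = "space M"]) auto
      also have "\<dots> \<le> e" using exp_W \<eta> n by (simp add: field_simps)
      finally have "1 - e \<le> 1 - prob {\<omega>\<in>space M. \<eta> * n \<le> W \<omega>}" by simp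
      also have "\<dots> = prob {\<omega>\<in>space M. \<not> \<eta> * n \<le> W \<omega>}"
        by (intro prob_neg[symmetric]) measurable
      also have "\<dots> \<le> prob {\<omega>\<in>space M. T n \<omega> > K}"
        using T_large by (intro finite_measure_mono) auto
      finally show ?case .
    qed
  qed
  have lim: "(\<lambda>n. prob {\<omega>\<in>space M. T n \<omega> > K}) \<longlonglongrightarrow> 1" for K
  proof (rule order_tendstoI)
    fix a :: real assume "a < 1"
    then have "(1 - a) / 2 > 0" by simp
    from large[OF this, of K] show "\<forall>\<^sub>F n in sequentially. a < prob {\<omega>\<in>space M. T n \<omega> > K}"
      by eventually_elim (use \<open>a < 1\<close> in argo)
  next
    fix a :: real assume "1 < a"
    then show "\<forall>\<^sub>F n in sequentially. prob {\<omega>\<in>space M. T n \<omega> > K} < a"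
      by (intro always_eventually allI) (rule le_less_trans[OF prob_le_1])
  qed
  \<comment> \<open>The claim about the quantile is \<open>lim\<close> with K =
    \<open>gumbel_quantile (1 - \<alpha>)\<close>.\<close>
  then show ?thesis by (simp add: tends_to_infinity_in_prob_def)
qed

end
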